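(* Let $\mathcal{O}$ be a connected set of $\Omega_N^{\mathbb{R},+}\times\mathcal{B}^{\mathbb{C}}$ and let $r_1<r_2$ be real numbers. Assume that each problem in $\mathcal{O}$ has exactly $k$ eigenvalues, and has exactly $m\ge0$ eigenvalues in $[r_1,r_2]$, all of which lie in $(r_1,r_2)$, where $m<k$ ($k,m$ independent of the problem). For $(\boldsymbol\omega,\mathbf{A})\in\mathcal{O}$ denote its other $k-m$ eigenvalues, those outside $[r_1,r_2]$, by $\hat\lambda_1(\boldsymbol\omega,\mathbf{A})\le\cdots\le\hat\lambda_{k-m}(\boldsymbol\omega,\mathbf{A})$. Then: (i) For each $1\le i\le k-m$, with $E_i:=\{\hat\lambda_i(\boldsymbol\omega,\mathbf{A}):(\boldsymbol\omega,\mathbf{A})\in\mathcal{O}\}$, either $E_i\subset(-\infty,r_1)$ or $E_i\subset(r_2,+\infty)$; there exists $0\le i_0\le k-1$ such that $\hat\lambda_i(\boldsymbol\omega,\mathbf{A})=\lambda_{i_0}(\boldsymbol\omega,\mathbf{A})$ for all $(\boldsymbol\omega,\mathbf{A})\in\mathcal{O}$; and consequently $\hat\lambda_i$ is continuous in $\mathcal{O}$. (ii) Further, assume that $(\boldsymbol\omega_0,\mathbf{A}_0)\in\bar{\mathcal{O}}\setminus\mathcal{O}$ has exactly $m$ eigenvalues, all of which are in $(r_1,r_2)$. If $E_i\subset(-\infty,r_1)$ for some $1\le i\le k-m$, then $\hat\lambda_i(\boldsymbol\omega,\mathbf{A})\to-\infty$ as $\mathcal{O}\ni(\boldsymbol\omega,\mathbf{A})\to(\boldsymbol\omega_0,\mathbf{A}_0)$.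 If $E_i\subset(r_2,+\infty)$ for some $1\le i\le k-m$, then $\hat\lambda_i(\boldsymbol\omega,\mathbf{A})\to+\infty$ as $\mathcal{O}\ni(\boldsymbol\omega,\mathbf{A})\to(\boldsymbol\omega_0,\mathbf{A}_0)$.
   Context: Fix an integer $N\ge 2$. A self-adjoint discrete Sturm–Liouville problem (SLP) is a pair $(\boldsymbol\omega,\mathbf{A})$. Here $\boldsymbol\omega=(1/f,q,w)$ with real sequences $f=\{f_n\}_{n=0}^N$, $q=\{q_n\}_{n=1}^N$, $w=\{w_n\}_{n=1}^N$, $f_n\ne0$, $w_n>0$, encodes the equation $-\nabla(f_n\Delta y_n)+q_ny_n=\lambda w_ny_n$, $1\le n\le N$, for $y=(y_0,\dots,y_{N+1})$, with $\Delta y_n=y_{n+1}-y_n$, $\nabla y_n=y_n-y_{n-1}$; the set $\Omega_N^{\mathbb{R},+}$ of all such $(1/f,q,w)$ has the topology of a subset of $\mathbb{R}^{3N+1}$. $\mathbf{A}=[A\,|\,B]$ encodes the boundary condition $A\begin{pmatrix}y_0\\ f_0\Delta y_0\end{pmatrix}+B\begin{pmatrix}y_N\\ f_N\Delta y_N\end{pmatrix}=0$, where $A,B$ are complex $2\times2$ matrices with $\mathrm{rank}(A,B)=2$ and $AJA^*=BJB^*$, $J=\begin{pmatrix}0&1\\-1&0\end{pmatrix}$; $[A\,|\,B]$ is the class of the $2\times4$ matrix $(A,B)$ modulo left multiplication by $GL(2,\mathbb{C})$, and $\mathcal{B}^{\mathbb{C}}$ is the set of all such classes, topologized as a subspace of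 the quotient of the rank-2 complex $2\times 4$ matrices by $GL(2,\mathbb{C})$. $\Omega_N^{\mathbb{R},+}\times\mathcal{B}^{\mathbb{C}}$ has the product topology, and $\bar{\mathcal{O}}$ is the closure of $\mathcal{O}$ in it. An eigenvalue of $(\boldsymbol\omega,\mathbf{A})$ is a $\lambda$ for which a nonzero $y$ solves the equation and the boundary condition. Eigenvalues are real and finite in number; they are counted with multiplicity (the dimension of the solution space) and listed as $\lambda_0(\boldsymbol\omega,\mathbf{A})\le\lambda_1(\boldsymbol\omega,\mathbf{A})\le\cdots$. *)

theory Defs
  imports "HOL-Analysis.Analysis" "HOL-Library.Function_Algebras"
begin

text \<open>A pair \<open>(A, B)\<close> of complex \<open>2 \<times> 2\<close> matrices stands for the \<open>2 \<times> 4\<close> matrix with left half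
  \<open>A\<close> and right half \<open>B\<close>; the product topology on pairs is that of \<open>\<complex>\<^sup>8\<close>.\<close>

type_synonym mat22 = "complex^2^2"

definition hcat :: "mat22 \<Rightarrow> mat22 \<Rightarrow> complex^(2+2)^2"
  where "hcat A B = (\<chi> i j. case j of Inl c \<Rightarrow> A $ i $ c | Inr c \<Rightarrow> B $ i $ c)"

definition rank2_matrices :: "(mat22 \<times> mat22) set"
  where "rank2_matrices = {(A, B). rank (hcat A B) = 2}"

definition ctranspose :: "mat22 \<Rightarrow> mat22"
  where "ctranspose A = (\<chi> i j. cnj (A $ j $ i))"

definition Jmat :: mat22
  where "Jmat = vector [vector [0, 1], vector [-1, 0]]"

definition selfadjoint_matrices :: "(mat22 \<times> mat22) set"
  where "selfadjoint_matrices = {(A, B) \<in> rank2_matrices.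
    A ** Jmat ** ctranspose A = B ** Jmat ** ctranspose B}"

definition bc_class :: "mat22 \<times> mat22 \<Rightarrow> (mat22 \<times> mat22) set"
  where "bc_class = (\<lambda>(A, B). {(G ** A, G ** B) | G. invertible G})"

definition quotient_topology_of :: "'a topology \<Rightarrow> ('a \<Rightarrow> 'b) \<Rightarrow> 'b topology"
  where "quotient_topology_of X p =
    topology (\<lambda>U. U \<subseteq> p ` topspace X \<and> openin X {x \<in> topspace X. p x \<in> U})"

lemma openin_quotient_topology_of:
  "openin (quotient_topology_of X p) U \<longleftrightarrow>
     U \<subseteq> p ` topspace X \<and> openin X {x \<in> topspace X. p x \<in> U}"
proof -
  have "istopology (\<lambda>U. U \<subseteq> p ` topspace X \<and> openin X {x \<in> topspace X. p x \<in> U})"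
    unfolding istopology_def
  proof (intro conjI allI impI)
    fix S T
    assume S: "S \<subseteq> p ` topspace X \<and> openin X {x \<in> topspace X. p x \<in> S}"
      and T: "T \<subseteq> p ` topspace X \<and> openin X {x \<in> topspace X. p x \<in> T}"
    then show "S \<inter> T \<subseteq> p ` topspace X" by blast
    have "{x \<in> topspace X. p x \<in> S \<inter> T} =
        {x \<in> topspace X. p x \<in> S} \<inter> {x \<in> topspace X. p x \<in> T}" by blast
    then show "openin X {x \<in> topspace X. p x \<in> S \<inter> T}" using S T by auto
  next
    fix K
    assume K: "\<forall>U\<in>K. U \<subseteq> p ` topspace X \<and> openin X {x \<in> topspace X. p x \<in> U}"
    then show "\<Union>K \<subseteq> p ` topspace X" by blast
    have "{x \<in> topspace X. p x \<in> \<Union>K} = \<Union>((\<lambda>U. {x \<in> topspace X. p x \<in> U}) ` K)" by blast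
    then show "openin X {x \<in> topspace X. p x \<in> \<Union>K}" using K by auto
  qed
  then show ?thesis by (simp add: quotient_topology_of_def topology_inverse')
qed

lemma topspace_quotient_topology_of: "topspace (quotient_topology_of X p) = p ` topspace X"
proof -
  have "{x \<in> topspace X. p x \<in> p ` topspace X} = topspace X" by blast
  then have "openin (quotient_topology_of X p) (p ` topspace X)"
    by (simp add: openin_quotient_topology_of)
  then show ?thesis
    by (metis openin_quotient_topology_of openin_subset openin_topspace subset_antisym)
qed

lemma quotient_map_quotient_topology_of: "quotient_map X (quotient_topology_of X p) p"
  by (simp add: quotient_map_def topspace_quotient_topology_of openin_quotient_topology_of)

definition bc_space :: "(mat22 \<times> mat22) set topology"
  where "bc_space =
    subtopology (quotient_topology_of (top_of_set rank2_matrices) bc_class)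
      (bc_class ` selfadjoint_matrices)"

text \<open>An equation is a triple \<open>(g, q, w)\<close> with \<open>g = 1/f\<close>; finite sequences are functions that are
  \<open>undefined\<close> outside their index range, and the factors below are \<open>\<real>\<^sup>N\<^sup>+\<^sup>1\<close>, \<open>\<real>\<^sup>N\<close>, \<open>\<real>\<^sup>N\<close>.\<close>

type_synonym sl_equation = "(nat \<Rightarrow> real) \<times> (nat \<Rightarrow> real) \<times> (nat \<Rightarrow> real)"

definition eq_space :: "nat \<Rightarrow> sl_equation topology"
  where "eq_space N =
    subtopology
      (prod_topology (product_topology (\<lambda>_. euclideanreal) {0..N})
        (prod_topology (product_topology (\<lambda>_. euclideanreal) {1..N})
          (product_topology (\<lambda>_. euclideanreal) {1..N})))
      {(g, q, w). (\<forall>n\<in>{0..N}. g n \<noteq> 0) \<and> (\<forall>n\<in>{1..N}. w n > 0)}"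

type_synonym sl_problem = "sl_equation \<times> (mat22 \<times> mat22) set"

definition slp_space :: "nat \<Rightarrow> sl_problem topology"
  where "slp_space N = prod_topology (eq_space N) bc_space"

definition fwd_diff :: "(nat \<Rightarrow> complex) \<Rightarrow> nat \<Rightarrow> complex"
  where "fwd_diff y n = y (n + 1) - y n"

definition bwd_diff :: "(nat \<Rightarrow> complex) \<Rightarrow> nat \<Rightarrow> complex"
  where "bwd_diff y n = y n - y (n - 1)"

text \<open>The vector \<open>(y\<^sub>0, \<dots>, y\<^sub>N\<^sub>+\<^sub>1)\<close> is a sequence that vanishes beyond \<open>N + 1\<close>. Any representative of the
  class \<open>\<AA>\<close> gives the same boundary condition.\<close>

definition eigenspace :: "nat \<Rightarrow> sl_problem \<Rightarrow> complex \<Rightarrow> (nat \<Rightarrow> complex) set"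
  where "eigenspace N = (\<lambda>((g, q, w), \<AA>) l.
    let f = (\<lambda>n. complex_of_real (1 / g n)) in
    {y. (\<forall>n>N + 1. y n = 0) \<and>
        (\<forall>n\<in>{1..N}. - bwd_diff (\<lambda>n. f n * fwd_diff y n) n + of_real (q n) * y n
                      = l * of_real (w n) * y n) \<and>
        (\<forall>(A, B)\<in>\<AA>. A *v vector [y 0, f 0 * fwd_diff y 0]
                      + B *v vector [y N, f N * fwd_diff y N] = 0)})"

definition eigenvalues :: "nat \<Rightarrow> sl_problem \<Rightarrow> complex set"
  where "eigenvalues N P = {l. \<exists>y\<in>eigenspace N P l. y \<noteq> (\<lambda>_. 0)}"

global_interpretation seq: vector_space "\<lambda>(c::complex) (y :: nat \<Rightarrow> complex) n. c * y n"
  defines seq_dim = seq.dim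
  by unfold_locales (auto simp: fun_eq_iff algebra_simps)

definition eig_mult :: "nat \<Rightarrow> sl_problem \<Rightarrow> complex \<Rightarrow> nat"
  where "eig_mult N P l = seq_dim (eigenspace N P l)"

definition has_exactly :: "nat \<Rightarrow> sl_problem \<Rightarrow> nat \<Rightarrow> complex set \<Rightarrow> bool"
  where "has_exactly N P j S \<longleftrightarrow>
    finite (eigenvalues N P \<inter> S) \<and> (\<Sum>l\<in>eigenvalues N P \<inter> S. eig_mult N P l) = j"

text \<open>All eigenvalues are real; they are listed in nondecreasing order, repeated according to
  multiplicity.\<close>

definition eig_list :: "nat \<Rightarrow> sl_problem \<Rightarrow> real list"
  where "eig_list N P =
    concat (map (\<lambda>x. replicate (eig_mult N P (complex_of_real x)) x)
      (sorted_list_of_set {x. complex_of_real x \<in> eigenvalues N P}))"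

definition eig :: "nat \<Rightarrow> nat \<Rightarrow> sl_problem \<Rightarrow> real"
  where "eig N n P = eig_list N P ! n"

text \<open>The eigenvalues outside \<open>[r1, r2]\<close>, numbered from \<open>1\<close>.\<close>

definition eig_hat :: "nat \<Rightarrow> real \<Rightarrow> real \<Rightarrow> nat \<Rightarrow> sl_problem \<Rightarrow> real"
  where "eig_hat N r1 r2 i P = filter (\<lambda>x. x \<notin> {r1..r2}) (eig_list N P) ! (i - 1)"

end

theory Submission
  imports Defs "HOL-Computational_Algebra.Fundamental_Theorem_Algebra"
begin

text \<open>On a representative \<open>(A, B)\<close> of the boundary condition, the eigenvalues are the roots of a
  polynomial \<open>p\<close> of degree at most \<open>2N\<close> whose values depend continuously on the problem. By the
  Lagrange identity its roots are real and the order of a root is the dimension of the eigenspace.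
  For a polynomial with real roots, the ratio of the moduli at \<open>t + id\<close> and \<open>t + ie\<close> bounds the
  number of roots near \<open>t\<close> from below, hence the number of eigenvalues in an open set is lower
  semicontinuous even where \<open>p\<close> changes its degree; similarly the spectrum cannot appear suddenly in
  a compact set. As the numbers of eigenvalues below \<open>r\<^sub>1\<close> and above \<open>r\<^sub>2\<close> add up to the constant
  \<open>k - m\<close>, lower semicontinuity of both makes both locally constant, hence constant on the connected
  set. The same device with the constant \<open>k\<close> gives continuity, and near a problem without
  eigenvalues outside \<open>(r\<^sub>1, r\<^sub>2)\<close> the remaining eigenvalues must leave every compact set.\<close>

section \<open>Boundary conditions as isotropic systems\<close>

text \<open>The leading coefficient of the characteristic polynomial can vanish in a limit;
  eigenvalues then escape to infinity, and the total number of roots is not stable. Hence nothing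
  here tracks roots through coefficients: every estimate uses the values at a few fixed points
  together with the uniform degree bound \<open>2 * N\<close>. Real roots make this possible.
  Raising the evaluation point from height d to height e above t stretches the distance to a real
  root by at most e/d, and only by a bounded factor if the root is at distance at least e from t.
  Strong growth therefore certifies many roots near t. The polynomial belongs to a pair of matrices
  and not to its class: another representative multiplies it by a nonzero determinant. So the
  estimates are made for representatives and carried to problems by openness of the projection.
  Self-adjointness is a condition on the rows of (A, B), whereas the Lagrange identity needs one on
  boundary values, that is, on the kernel. Passing from the one to the other is the task of the
  linear algebra in \<open>complex^4\<close>.\<close>

lemma vec_dim_pair_eq_2_iff:
  fixes u v :: "'a::field ^ 'n"
  shows "vec.dim {u, v} = 2 \<longleftrightarrow> (\<forall>a b. a *s u + b *s v = 0 \<longrightarrow> a = 0 \<and> b = 0)"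
proof
  assume d: "vec.dim {u, v} = 2"
  \<comment> \<open>\<open>{u, v}\<close> is a set and collapses if the vectors coincide, so this
    case has to be excluded before independence of the set says anything about two
    coefficients.\<close>
  have ne: "u \<noteq> v"
  proof
    assume "u = v"
    then have "vec.dim {u, v} \<le> card {u}"
      by (intro vec.dim_le_card) (auto intro: vec.span_base)
    with d show False by simp
  qed
  have ind: "vec.independent {u, v}"
    using d ne by (intro vec.card_le_dim_spanning[of _ "vec.span {u, v}"]) (auto intro: vec.span_base)
  show "\<forall>a b. a *s u + b *s v = 0 \<longrightarrow> a = 0 \<and> b = 0"
  proof (intro allI impI)
    fix a b assume h: "a *s u + b *s v = 0"
    let ?c = "\<lambda>x. if x = u then a else b"
    have "(\<Sum>x\<in>{u, v}. ?c x *s x) = a *s u + b *s v"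
      using ne by (subst sum.insert) auto
    with h have 0: "(\<Sum>x\<in>{u, v}. ?c x *s x) = 0" by (simp only:)
    have "?c u = 0" by (rule vec.independentD[OF ind _ subset_refl 0]) simp_all
    moreover have "?c v = 0" by (rule vec.independentD[OF ind _ subset_refl 0]) simp_all
    ultimately show "a = 0 \<and> b = 0" using ne by (simp split: if_splits)
  qed
next
  assume h: "\<forall>a b. a *s u + b *s v = 0 \<longrightarrow> a = 0 \<and> b = 0"
  have ne: "u \<noteq> v"
    using h[rule_format, of 1 "-1"] by auto
  have ind: "vec.independent {u, v}"
  proof
    assume "vec.dependent {u, v}"
    then obtain c where c: "\<exists>x\<in>{u, v}. c x \<noteq> 0" "(\<Sum>x\<in>{u, v}. c x *s x) = 0"
      using vec.dependent_finite[of "{u, v}"] by blast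
    from c(2) ne have "c u *s u + c v *s v = 0" by simp
    with h c(1) show False by blast
  qed
  show "vec.dim {u, v} = 2"
    using vec.dim_eq_card_independent[OF ind] ne by simp
qed

text \<open>Rank as row rank: independence of the two rows is the form in which
  \<open>isotropic_kernel\<close> needs the condition and in which its invariance under left
  multiplication is visible.\<close>

lemma rank2_matrices_iff:
  "(A, B) \<in> rank2_matrices \<longleftrightarrow>
    (\<forall>a b. (\<forall>j. a * A $ 1 $ j + b * A $ 2 $ j = 0 \<and> a * B $ 1 $ j + b * B $ 2 $ j = 0) \<longrightarrow> a = 0 \<and> b = 0)"
  (is "_ \<longleftrightarrow> ?R")
proof -
  let ?H = "hcat A B"
  have comb: "a *s ?H $ 1 + b *s ?H $ 2 = 0 \<longleftrightarrow>
      (\<forall>j. a * A $ 1 $ j + b * A $ 2 $ j = 0 \<and> a * B $ 1 $ j + b * B $ 2 $ j = 0)" for a b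
  proof
    assume h: "a *s ?H $ 1 + b *s ?H $ 2 = 0"
    have "(a *s ?H $ 1 + b *s ?H $ 2) $ Inl j = 0" "(a *s ?H $ 1 + b *s ?H $ 2) $ Inr j = 0" for j
      unfolding h by simp_all
    then show "\<forall>j. a * A $ 1 $ j + b * A $ 2 $ j = 0 \<and> a * B $ 1 $ j + b * B $ 2 $ j = 0"
      by (simp add: hcat_def)
  next
    assume h: "\<forall>j. a * A $ 1 $ j + b * A $ 2 $ j = 0 \<and> a * B $ 1 $ j + b * B $ 2 $ j = 0"
    then show "a *s ?H $ 1 + b *s ?H $ 2 = 0"
      by (auto simp: hcat_def vec_eq_iff split: sum.splits)
  qed
  have rows: "rows ?H = {?H $ 1, ?H $ 2}"
    by (auto simp: rows_def row_def UNIV_2)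
  have "rank ?H = 2 \<longleftrightarrow> (\<forall>a b. a *s ?H $ 1 + b *s ?H $ 2 = 0 \<longrightarrow> a = 0 \<and> b = 0)"
    unfolding row_rank_def_gen rows vec_dim_pair_eq_2_iff ..
  then show ?thesis
    unfolding rank2_matrices_def comb by simp
qed

text \<open>The kernel of a rank two isotropic system \<open>r, s\<close> is spanned by the images of \<open>r, s\<close> under
  conjugation followed by the symplectic form, which makes the kernel isotropic as well.\<close>

lemma isotropic_kernel:
  fixes r s x z :: "complex^4"
  defines "dot \<equiv> \<lambda>u v :: complex^4. \<Sum>i\<in>UNIV. u $ i * v $ i"
    and "sform \<equiv> \<lambda>u v :: complex^4.
      (u $ 1 * cnj (v $ 2) - u $ 2 * cnj (v $ 1)) - (u $ 3 * cnj (v $ 4) - u $ 4 * cnj (v $ 3))"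
  assumes indep: "\<And>a b. a *s r + b *s s = 0 \<Longrightarrow> a = 0 \<and> b = 0"
    and iso: "sform r r = 0" "sform r s = 0" "sform s r = 0" "sform s s = 0"
    and x: "dot r x = 0" "dot s x = 0" and z: "dot r z = 0" "dot s z = 0"
  shows "sform x z = 0"
proof -
  \<comment> \<open>\<open>k\<close> is chosen such that \<open>dot u (k v) = sform u v\<close>;
    isotropy of the rows then says that \<open>k r\<close> and \<open>k s\<close> lie in the
    kernel.\<close>
  define k where "k = (\<lambda>u :: complex^4. vector [cnj (u $ 2), - cnj (u $ 1), - cnj (u $ 4), cnj (u $ 3)] :: complex^4)"
  define c where "c = (\<lambda>u :: complex^4. \<chi> i. cnj (u $ i))"
  define f where "f = (\<lambda>v :: complex^4. v $ 1 *s k r + v $ 2 *s k s + (v $ 3 *s c r + v $ 4 *s c s))"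
  have dot: "dot u v = u $ 1 * v $ 1 + u $ 2 * v $ 2 + u $ 3 * v $ 3 + u $ 4 * v $ 4" for u v
    by (simp add: dot_def sum_4)
  have k: "k u $ 1 = cnj (u $ 2)" "k u $ 2 = - cnj (u $ 1)" "k u $ 3 = - cnj (u $ 4)" "k u $ 4 = cnj (u $ 3)" for u
    by (simp_all add: k_def vector_def)
  have dotk: "dot u (k v) = sform u v" for u v
    by (simp add: dot k sform_def algebra_simps)
  have dot_lin: "dot u (a *s v) = a * dot u v" "dot u (v + w) = dot u v + dot u w" for u v w a
    by (simp_all add: dot algebra_simps)
  \<comment> \<open>The Gram matrix of the independent rows is positive definite: the combination
    \<open>n\<close> of the conjugated rows satisfies \<open>dot (c n) n\<close> = sum of squared
    moduli.\<close>
  have pos: "a = 0 \<and> b = 0" if h: "dot r (a *s c r + b *s c s) = 0" "dot s (a *s c r + b *s c s) = 0" for a b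
  proof -
    define n where "n = a *s c r + b *s c s"
    have "cnj a * dot r n + cnj b * dot s n = dot (c n) n"
      by (simp add: dot n_def c_def algebra_simps)
    with h have "dot (c n) n = 0" by (simp add: n_def)
    moreover have "dot (c n) n = complex_of_real ((cmod (n $ 1))\<^sup>2 + (cmod (n $ 2))\<^sup>2 + (cmod (n $ 3))\<^sup>2 + (cmod (n $ 4))\<^sup>2)"
      unfolding of_real_add complex_norm_square by (simp add: dot c_def mult.commute)
    ultimately have "complex_of_real ((cmod (n $ 1))\<^sup>2 + (cmod (n $ 2))\<^sup>2 + (cmod (n $ 3))\<^sup>2 + (cmod (n $ 4))\<^sup>2) = 0"
      by simp
    then have "(cmod (n $ 1))\<^sup>2 + (cmod (n $ 2))\<^sup>2 + (cmod (n $ 3))\<^sup>2 + (cmod (n $ 4))\<^sup>2 = 0"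
      using of_real_eq_0_iff by blast
    then have n0: "n $ 1 = 0" "n $ 2 = 0" "n $ 3 = 0" "n $ 4 = 0"
      by (simp_all add: add_nonneg_eq_0_iff)
    have "cnj (n $ i) = 0" for i
      using n0 exhaust_4[of i] by auto
    then have "cnj a *s r + cnj b *s s = 0"
      unfolding vec_eq_iff by (simp add: n_def c_def)
    from indep[OF this] show ?thesis by simp
  qed
  have lin: "Vector_Spaces.linear (*s) (*s) f"
    by unfold_locales (auto simp: f_def vec_eq_iff algebra_simps)
  have dotf: "dot u (f v) = v $ 1 * sform u r + v $ 2 * sform u s + dot u (v $ 3 *s c r + v $ 4 *s c s)" for u v
    by (simp add: f_def dot_lin dotk)
  have inj: "inj f"
    unfolding vec.linear_inj_iff_eq_0[OF lin]
  proof (intro allI impI)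
    fix v assume v: "f v = 0"
    have "dot u (f v) = 0" for u unfolding v by (simp add: dot)
    from this[of r] this[of s] have "dot r (v $ 3 *s c r + v $ 4 *s c s) = 0" "dot s (v $ 3 *s c r + v $ 4 *s c s) = 0"
      by (simp_all add: dotf iso)
    from pos[OF this] have v34: "v $ 3 = 0" "v $ 4 = 0" by auto
    have "v $ 1 *s k r + v $ 2 *s k s = 0"
      using v unfolding f_def v34 by simp
    then have e: "v $ 1 * k r $ i + v $ 2 * k s $ i = 0" for i
      by (simp add: vec_eq_iff)
    have "cnj (v $ 1) * r $ 2 + cnj (v $ 2) * s $ 2 = 0" "cnj (v $ 1) * r $ 3 + cnj (v $ 2) * s $ 3 = 0"
      using arg_cong[OF e[of 1], of cnj] arg_cong[OF e[of 4], of cnj] by (simp_all add: k)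
    moreover have "- (cnj (v $ 1) * r $ 1 + cnj (v $ 2) * s $ 1) = 0" "- (cnj (v $ 1) * r $ 4 + cnj (v $ 2) * s $ 4) = 0"
      using arg_cong[OF e[of 2], of cnj] arg_cong[OF e[of 3], of cnj] by (simp_all add: k)
    ultimately have "cnj (v $ 1) * r $ i + cnj (v $ 2) * s $ i = 0" for i
      using exhaust_4[of i] unfolding neg_equal_0_iff_equal by metis
    then have "cnj (v $ 1) *s r + cnj (v $ 2) *s s = 0"
      by (simp add: vec_eq_iff)
    from indep[OF this] v34 have "v $ i = 0" for i using exhaust_4[of i] by auto
    then show "v = 0" by (simp add: vec_eq_iff)
  qed
  \<comment> \<open>Dimension four: the injective \<open>f\<close> is onto, so \<open>k r\<close>,
    \<open>k s\<close>, \<open>c r\<close>, \<open>c s\<close> form a basis. For \<open>x\<close> in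
    the kernel the coefficients of \<open>c r\<close> and \<open>c s\<close> vanish by
    \<open>pos\<close>.\<close>
  have "surj f" by (rule vec.linear_inj_imp_surj[OF lin inj])
  then obtain v where v: "x = f v" by (metis surjD)
  have "dot r (v $ 3 *s c r + v $ 4 *s c s) = 0" "dot s (v $ 3 *s c r + v $ 4 *s c s) = 0"
    using x unfolding v dotf iso by simp_all
  from pos[OF this] have xv: "x = v $ 1 *s k r + v $ 2 *s k s"
    using v unfolding f_def by simp
  have "sform x z = (v $ 1 * cnj (dot r z) + v $ 2 * cnj (dot s z))"
    unfolding xv sform_def dot by (simp add: k algebra_simps)
  then show ?thesis using z by simp
qed

section \<open>The characteristic polynomial\<close>

text \<open>The pair is (y_n, f_n \<Delta>y_n) as polynomials in the spectral parameter. With g =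
  1/f the recursion is free of division, which makes continuity in the equation immediate. The
  initial values U, V are polynomials too, because the proof for simple eigenvalues uses initial
  values that vary with the spectral parameter.\<close>

primrec sl_sol :: "sl_equation \<Rightarrow> complex poly \<Rightarrow> complex poly \<Rightarrow> nat \<Rightarrow> complex poly \<times> complex poly"
  where
    "sl_sol e U V 0 = (U, V)"
  | "sl_sol e U V (Suc n) =
      (let y = fst (sl_sol e U V n) + smult (of_real (fst e n)) (snd (sl_sol e U V n))
       in (y, snd (sl_sol e U V n) + [:of_real (fst (snd e) (Suc n)), - of_real (snd (snd e) (Suc n)):] * y))"

abbreviation solY :: "sl_equation \<Rightarrow> complex poly \<Rightarrow> complex poly \<Rightarrow> nat \<Rightarrow> complex poly"
  where "solY e U V n \<equiv> fst (sl_sol e U V n)"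

abbreviation solF :: "sl_equation \<Rightarrow> complex poly \<Rightarrow> complex poly \<Rightarrow> nat \<Rightarrow> complex poly"
  where "solF e U V n \<equiv> snd (sl_sol e U V n)"

definition bc_row :: "mat22 \<times> mat22 \<Rightarrow> 2 \<Rightarrow> complex \<Rightarrow> complex \<Rightarrow> complex \<Rightarrow> complex \<Rightarrow> complex"
  where "bc_row X i a b c d = fst X $ i $ 1 * a + fst X $ i $ 2 * b + (snd X $ i $ 1 * c + snd X $ i $ 2 * d)"

definition bc_poly :: "nat \<Rightarrow> sl_equation \<Rightarrow> mat22 \<times> mat22 \<Rightarrow> 2 \<Rightarrow> complex poly \<Rightarrow> complex poly \<Rightarrow> complex poly"
  where "bc_poly N e X i U V =
    smult (fst X $ i $ 1) U + smult (fst X $ i $ 2) V +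
    (smult (snd X $ i $ 1) (solY e U V N) + smult (snd X $ i $ 2) (solF e U V N))"

text \<open>The determinant of the linear system which the boundary condition imposes on the initial
  values; its columns belong to the fundamental solutions with initial values (1, 0) and (0,
  1).\<close>

definition char_poly :: "nat \<Rightarrow> sl_equation \<Rightarrow> mat22 \<times> mat22 \<Rightarrow> complex poly"
  where "char_poly N e X =
    bc_poly N e X 1 1 0 * bc_poly N e X 2 0 1 - bc_poly N e X 1 0 1 * bc_poly N e X 2 1 0"

lemma sl_sol_linear:
  "solY e U V n = U * solY e 1 0 n + V * solY e 0 1 n \<and>
   solF e U V n = U * solF e 1 0 n + V * solF e 0 1 n"
  by (induction n) (simp_all add: Let_def algebra_simps smult_add_right)

lemma bc_poly_linear: "bc_poly N e X i U V = U * bc_poly N e X i 1 0 + V * bc_poly N e X i 0 1"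
  unfolding bc_poly_def
  using sl_sol_linear[of e U V N] by (simp add: algebra_simps smult_add_right)

lemma poly_bc_poly:
  "poly (bc_poly N e X i U V) l =
    bc_row X i (poly U l) (poly V l) (poly (solY e U V N) l) (poly (solF e U V N) l)"
  by (simp add: bc_poly_def bc_row_def)

lemma poly_pderiv_bc_poly:
  "poly (pderiv (bc_poly N e X i U V)) l =
    bc_row X i (poly (pderiv U) l) (poly (pderiv V) l)
      (poly (pderiv (solY e U V N)) l) (poly (pderiv (solF e U V N)) l)"
  by (simp add: bc_poly_def bc_row_def pderiv_add pderiv_smult)

lemma degree_sl_sol: "degree (solY e [:a:] [:b:] n) \<le> n \<and> degree (solF e [:a:] [:b:] n) \<le> n"
proof (induction n)
  case (Suc n)
  have 1: "degree (solY e [:a:] [:b:] (Suc n)) \<le> n"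
    using Suc by (auto simp: Let_def intro!: degree_add_le degree_smult_le[THEN order_trans])
  have "degree ([:of_real (fst (snd e) (Suc n)), - of_real (snd (snd e) (Suc n)):] * solY e [:a:] [:b:] (Suc n))
      \<le> 1 + n"
    by (rule order_trans[OF degree_mult_le add_mono[OF _ 1]]) simp
  then show ?case
    using Suc 1 by (auto simp: Let_def intro!: degree_add_le)
qed simp

text \<open>The bound need not be sharp. It has to be the same for all problems, since it becomes
  the constant \<open>2 ^ (2 * N)\<close> in the root count.\<close>

lemma degree_char_poly: "degree (char_poly N e X) \<le> 2 * N"
proof -
  have "degree (bc_poly N e X i [:a:] [:b:]) \<le> N" for i a b
    unfolding bc_poly_def using degree_sl_sol[of e a b N]
    by (intro degree_add_le degree_smult_le[THEN order_trans]) auto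
  then have d: "degree (bc_poly N e X i 1 0) \<le> N" "degree (bc_poly N e X i 0 1) \<le> N" for i
    by (metis one_pCons pCons_0_0)+
  have "degree (p * q) \<le> 2 * N" if "degree p \<le> N" "degree q \<le> N" for p q :: "complex poly"
    using degree_mult_le[of p q] that by linarith
  then show ?thesis
    unfolding char_poly_def by (intro degree_diff_le) (simp_all add: d)
qed

text \<open>Read (a, b, c, d) as (y_0, f_0 \<Delta>y_0, y_N, f_N \<Delta>y_N): the boundary terms of
  the Lagrange identity at 0 and at N cancel.\<close>

lemma selfadjoint_bc_isotropic:
  assumes X: "X \<in> selfadjoint_matrices"
    and y: "\<And>i. bc_row X i a b c d = 0" and z: "\<And>i. bc_row X i a' b' c' d' = 0"
  shows "cnj c' * d - cnj d' * c = cnj a' * b - cnj b' * a"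
proof -
  obtain A B where AB: "X = (A, B)" by fastforce
  let ?r = "\<lambda>i. vector [A $ i $ 1, A $ i $ 2, B $ i $ 1, B $ i $ 2] :: complex^4"
  let ?x = "vector [a, b, c, d] :: complex^4" and ?z = "vector [a', b', c', d'] :: complex^4"
  have v4: "(vector [p, q, s, t] :: complex^4) $ 1 = p" "(vector [p, q, s, t] :: complex^4) $ 2 = q"
    "(vector [p, q, s, t] :: complex^4) $ 3 = s" "(vector [p, q, s, t] :: complex^4) $ 4 = t" for p q s t
    by (simp_all add: vector_def)
  have AB': "(A, B) \<in> rank2_matrices" and S: "A ** Jmat ** ctranspose A = B ** Jmat ** ctranspose B"
    using X by (simp_all add: selfadjoint_matrices_def AB)
  have entry: "(C ** Jmat ** ctranspose C) $ i $ j = C $ i $ 1 * cnj (C $ j $ 2) - C $ i $ 2 * cnj (C $ j $ 1)" for C i j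
    by (simp add: matrix_matrix_mult_def Jmat_def ctranspose_def sum_2 algebra_simps)
  have iso: "(A $ i $ 1 * cnj (A $ j $ 2) - A $ i $ 2 * cnj (A $ j $ 1)) - (B $ i $ 1 * cnj (B $ j $ 2) - B $ i $ 2 * cnj (B $ j $ 1)) = 0" for i j
    using arg_cong[OF S, of "\<lambda>M. M $ i $ j"] unfolding entry by simp
  have "(a * cnj b' - b * cnj a') - (c * cnj d' - d * cnj c') = 0"
  proof (rule isotropic_kernel[of "?r 1" "?r 2" ?x ?z, unfolded v4 sum_4])
    fix p q assume "p *s ?r 1 + q *s ?r 2 = 0"
    then have e: "(p *s ?r 1 + q *s ?r 2) $ i = 0" for i by simp
    have "\<forall>j. p * A $ 1 $ j + q * A $ 2 $ j = 0 \<and> p * B $ 1 $ j + q * B $ 2 $ j = 0"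
      using e[of 1] e[of 2] e[of 3] e[of 4] by (simp add: v4 forall_2)
    with AB' show "p = 0 \<and> q = 0"
      unfolding rank2_matrices_iff by blast
  qed (use iso[of 1 1] iso[of 1 2] iso[of 2 1] iso[of 2 2] y[of 1] y[of 2] z[of 1] z[of 2] in
      \<open>simp_all add: bc_row_def AB add.assoc\<close>)
  then show ?thesis by (simp add: algebra_simps)
qed

section \<open>Order of the eigenvalues\<close>

text \<open>Summation by parts. The inhomogeneity \<open>h\<close> lets the same identity serve
  twice: \<open>h = 0\<close> for nonreal eigenvalues, and \<open>h = - w y\<close> for the
  derivative of a solution with respect to the spectral parameter.\<close>

lemma lagrange_identity:
  fixes y F z G h :: "nat \<Rightarrow> complex" and g q w :: "nat \<Rightarrow> real"
  assumes y: "\<And>n. y (Suc n) = y n + of_real (g n) * F n"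
    and F: "\<And>n. F (Suc n) = F n + (of_real (q (Suc n)) - l * of_real (w (Suc n))) * y (Suc n) + h (Suc n)"
    and z: "\<And>n. z (Suc n) = z n + of_real (g n) * G n"
    and G: "\<And>n. G (Suc n) = G n + (of_real (q (Suc n)) - l' * of_real (w (Suc n))) * z (Suc n)"
  shows "cnj (z n) * F n - cnj (G n) * y n = cnj (z 0) * F 0 - cnj (G 0) * y 0
    + (\<Sum>j<n. (cnj l' - l) * of_real (w (Suc j)) * y (Suc j) * cnj (z (Suc j)) + cnj (z (Suc j)) * h (Suc j))"
proof (induction n)
  case (Suc n)
  have "cnj (z (Suc n)) * F (Suc n) - cnj (G (Suc n)) * y (Suc n) =
      (cnj (z (Suc n)) * F n - cnj (G n) * y (Suc n)) +
      ((cnj l' - l) * of_real (w (Suc n)) * y (Suc n) * cnj (z (Suc n)) + cnj (z (Suc n)) * h (Suc n))"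
    unfolding F G by (simp add: algebra_simps)
  also have "cnj (z (Suc n)) * F n - cnj (G n) * y (Suc n) = cnj (z n) * F n - cnj (G n) * y n"
    unfolding y z by (simp add: algebra_simps)
  finally show ?case using Suc.IH by simp
qed simp

lemma det_eq_0_imp_kernel:
  fixes a b c d :: "'a::field"
  assumes "a * d - b * c = 0"
  obtains u v where "\<not> (u = 0 \<and> v = 0)" "a * u + b * v = 0" "c * u + d * v = 0"
proof (cases "a = 0 \<and> b = 0")
  case True
  show ?thesis
  proof (cases "c = 0 \<and> d = 0")
    case True
    with \<open>a = 0 \<and> b = 0\<close> show ?thesis by (intro that[of 1 0]) auto
  next
    case False
    with True show ?thesis by (intro that[of d "- c"]) (auto simp: algebra_simps)
  qed
next
  case False
  with assms show ?thesis by (intro that[of b "- a"]) (auto simp: algebra_simps)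
qed

text \<open>The data of a point of \<open>eq_space N\<close> with a self-adjoint pair in place of
  its class, on which the polynomial is not well defined.\<close>

locale sl_representative =
  fixes N :: nat and g q w :: "nat \<Rightarrow> real" and X :: "mat22 \<times> mat22"
  assumes N: "2 \<le> N"
    and g: "\<And>n. n \<le> N \<Longrightarrow> g n \<noteq> 0"
    and w: "\<And>n. 1 \<le> n \<Longrightarrow> n \<le> N \<Longrightarrow> w n > 0"
    and X: "X \<in> selfadjoint_matrices"
begin

abbreviation "e \<equiv> (g, q, w)"

lemma sol_rec:
  "poly (solY e U V (Suc n)) l = poly (solY e U V n) l + of_real (g n) * poly (solF e U V n) l"
  "poly (solF e U V (Suc n)) l = poly (solF e U V n) l +
    (of_real (q (Suc n)) - l * of_real (w (Suc n))) * poly (solY e U V (Suc n)) l"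
  "poly (pderiv (solY e U V (Suc n))) l =
    poly (pderiv (solY e U V n)) l + of_real (g n) * poly (pderiv (solF e U V n)) l"
  "poly (pderiv (solF e U V (Suc n))) l = poly (pderiv (solF e U V n)) l +
    (of_real (q (Suc n)) - l * of_real (w (Suc n))) * poly (pderiv (solY e U V (Suc n))) l
    + - of_real (w (Suc n)) * poly (solY e U V (Suc n)) l"
proof -
  have Y: "solY e U V (Suc n) = solY e U V n + smult (of_real (g n)) (solF e U V n)"
    by (simp add: Let_def)
  have F: "solF e U V (Suc n) = solF e U V n +
      [:of_real (q (Suc n)), - of_real (w (Suc n)):] * solY e U V (Suc n)"
    by (simp add: Let_def)
  show "poly (solY e U V (Suc n)) l = poly (solY e U V n) l + of_real (g n) * poly (solF e U V n) l"
    "poly (pderiv (solY e U V (Suc n))) l =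
      poly (pderiv (solY e U V n)) l + of_real (g n) * poly (pderiv (solF e U V n)) l"
    unfolding Y by (simp_all add: pderiv_add pderiv_smult)
  show "poly (solF e U V (Suc n)) l = poly (solF e U V n) l +
    (of_real (q (Suc n)) - l * of_real (w (Suc n))) * poly (solY e U V (Suc n)) l"
    unfolding F poly_add poly_mult by simp
  show "poly (pderiv (solF e U V (Suc n))) l = poly (pderiv (solF e U V n)) l +
    (of_real (q (Suc n)) - l * of_real (w (Suc n))) * poly (pderiv (solY e U V (Suc n))) l
    + - of_real (w (Suc n)) * poly (solY e U V (Suc n)) l"
    unfolding F pderiv_add pderiv_mult poly_add poly_mult
    by (simp add: pderiv_pCons mult.commute del: sl_sol.simps)
qed

text \<open>Positivity of w gives y_1 = ... = y_N = 0. Since N is at least 2, two consecutive values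
  vanish; this determines f_1 \<Delta>y_1 = 0, and the recursion run backwards reaches the initial
  values.\<close>

lemma weighted_norm_eq_0_imp:
  assumes "(\<Sum>j<N. of_real (w (Suc j)) * poly (solY e U V (Suc j)) l * cnj (poly (solY e U V (Suc j)) l)) = 0"
  shows "poly U l = 0" "poly V l = 0"
proof -
  let ?y = "\<lambda>n. poly (solY e U V n) l" and ?F = "\<lambda>n. poly (solF e U V n) l"
  have "complex_of_real (\<Sum>j<N. w (Suc j) * (cmod (?y (Suc j)))\<^sup>2) = 0"
    using assms unfolding of_real_sum of_real_mult complex_norm_square by (simp add: mult.assoc)
  then have "(\<Sum>j<N. w (Suc j) * (cmod (?y (Suc j)))\<^sup>2) = 0"
    using of_real_eq_0_iff by blast
  then have 0: "w (Suc j) * (cmod (?y (Suc j)))\<^sup>2 = 0" if "j < N" for j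
    using that w by (subst (asm) sum_nonneg_eq_0_iff) (auto simp: less_imp_le)
  have y0: "?y (Suc j) = 0" if "j < N" for j
    using 0[OF that] w[of "Suc j"] that by auto
  have "of_real (g 1) * ?F 1 = 0"
    using sol_rec(1)[of U V 1 l] y0[of 0] y0[of 1] N by simp
  then have F1: "?F 1 = 0" using g[of 1] N by simp
  then have F0: "?F 0 = 0"
    using sol_rec(2)[of U V 0 l] y0[of 0] N by simp
  then show "poly V l = 0" by simp
  show "poly U l = 0"
    using sol_rec(1)[of U V 0 l] y0[of 0] N F0 by simp
qed

text \<open>The Lagrange identity of the solution with itself leaves \<open>cnj l - l\<close> times
  the weighted square norm, and this factor is nonzero off the real axis.\<close>

lemma bc_nonreal_imp_0:
  assumes l: "Im l \<noteq> 0" and bc: "\<And>i. poly (bc_poly N e X i U V) l = 0"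
  shows "poly U l = 0 \<and> poly V l = 0"
proof -
  let ?y = "\<lambda>n. poly (solY e U V n) l" and ?F = "\<lambda>n. poly (solF e U V n) l"
  have "cnj (?y N) * ?F N - cnj (?F N) * ?y N = cnj (?y 0) * ?F 0 - cnj (?F 0) * ?y 0"
    using selfadjoint_bc_isotropic[OF X bc[unfolded poly_bc_poly] bc[unfolded poly_bc_poly]] by simp
  with lagrange_identity[of ?y g ?F q l w "\<lambda>_. 0" ?y ?F l N] sol_rec(1,2)
  have "(\<Sum>j<N. (cnj l - l) * of_real (w (Suc j)) * ?y (Suc j) * cnj (?y (Suc j))) = 0"
    by (simp del: sl_sol.simps)
  then have "(cnj l - l) * (\<Sum>j<N. of_real (w (Suc j)) * ?y (Suc j) * cnj (?y (Suc j))) = 0"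
    by (simp add: sum_distrib_left mult.assoc del: sl_sol.simps)
  then have "cnj l - l = 0 \<or> (\<Sum>j<N. of_real (w (Suc j)) * ?y (Suc j) * cnj (?y (Suc j))) = 0"
    unfolding mult_eq_0_iff .
  moreover have "cnj l - l \<noteq> 0" using l by (simp add: complex_eq_iff)
  ultimately have 0: "(\<Sum>j<N. of_real (w (Suc j)) * ?y (Suc j) * cnj (?y (Suc j))) = 0"
    by argo
  show ?thesis using weighted_norm_eq_0_imp[OF 0] by (rule conjI)
qed

text \<open>The derivative \<open>u\<close> of the solution \<open>y\<close> with respect to the spectral parameter solves the
  equation with the inhomogeneity \<open>w y\<close> and satisfies the boundary condition, so that the symmetry
  of the problem makes \<open>\<Sum>w\<bar>y\<bar>\<^sup>2\<close> vanish.\<close>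

lemma bc_double_zero_imp_0:
  assumes l: "Im l = 0" and bc: "\<And>i. poly (bc_poly N e X i U V) l = 0"
    and bc': "\<And>i. poly (pderiv (bc_poly N e X i U V)) l = 0"
  shows "poly U l = 0 \<and> poly V l = 0"
proof -
  let ?y = "\<lambda>n. poly (solY e U V n) l" and ?F = "\<lambda>n. poly (solF e U V n) l"
  let ?u = "\<lambda>n. poly (pderiv (solY e U V n)) l" and ?H = "\<lambda>n. poly (pderiv (solF e U V n)) l"
  have "cnj (?y N) * ?H N - cnj (?F N) * ?u N = cnj (?y 0) * ?H 0 - cnj (?F 0) * ?u 0"
    using selfadjoint_bc_isotropic[OF X bc'[unfolded poly_pderiv_bc_poly] bc[unfolded poly_bc_poly]] by simp
  with lagrange_identity[of ?u g ?H q l w "\<lambda>n. - of_real (w n) * ?y n" ?y ?F l N, OF sol_rec(3,4,1,2)]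
  have "(\<Sum>j<N. (cnj l - l) * of_real (w (Suc j)) * ?u (Suc j) * cnj (?y (Suc j)) +
      cnj (?y (Suc j)) * (- of_real (w (Suc j)) * ?y (Suc j))) = 0"
    by (simp del: sl_sol.simps)
  moreover have "cnj l - l = 0" using l by (simp add: complex_eq_iff)
  ultimately have "- (\<Sum>j<N. of_real (w (Suc j)) * ?y (Suc j) * cnj (?y (Suc j))) = 0"
    unfolding sum_negf[symmetric] by (simp add: mult_ac del: sl_sol.simps)
  then have 0: "(\<Sum>j<N. of_real (w (Suc j)) * ?y (Suc j) * cnj (?y (Suc j))) = 0"
    unfolding neg_equal_0_iff_equal .
  show ?thesis using weighted_norm_eq_0_imp[OF 0] by (rule conjI)
qed

definition M :: "2 \<Rightarrow> 2 \<Rightarrow> complex poly"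
  where "M i j = (if j = 1 then bc_poly N e X i 1 0 else bc_poly N e X i 0 1)"

abbreviation D :: "complex poly" where "D \<equiv> char_poly N e X"

lemma D_eq: "D = M 1 1 * M 2 2 - M 1 2 * M 2 1"
  by (simp add: char_poly_def M_def)

lemma bc_poly_eq: "bc_poly N e X i U V = U * M i 1 + V * M i 2"
  by (simp add: M_def bc_poly_linear[of N e X i U V])

lemma char_poly_root_real:
  assumes "poly D l = 0" shows "Im l = 0"
proof (rule ccontr)
  assume "Im l \<noteq> 0"
  have "poly (M 1 1) l * poly (M 2 2) l - poly (M 1 2) l * poly (M 2 1) l = 0"
    using assms by (simp add: D_eq)
  then obtain u v where uv: "\<not> (u = 0 \<and> v = 0)"
    "poly (M 1 1) l * u + poly (M 1 2) l * v = 0" "poly (M 2 1) l * u + poly (M 2 2) l * v = 0"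
    by (rule det_eq_0_imp_kernel)
  have "poly (bc_poly N e X i [:u:] [:v:]) l = 0" for i
    unfolding bc_poly_eq using uv exhaust_2[of i] by (auto simp: mult.commute)
  from bc_nonreal_imp_0[OF \<open>Im l \<noteq> 0\<close> this] uv show False by simp
qed

lemma char_poly_nonzero: "D \<noteq> 0"
proof
  assume "D = 0"
  then have "poly D \<i> = 0" by (simp only: poly_0)
  from char_poly_root_real[OF this] show False by simp
qed

text \<open>The initial values (\<open>M i 2\<close>, \<open>- M i 1\<close>), which depend on the
  spectral parameter, solve row i identically and turn the other row into D up to sign. A double
  zero of D would make both rows and their derivatives vanish at l, so
  \<open>bc_double_zero_imp_0\<close> would force row i of the matrix to vanish there.\<close>

lemma order_char_poly_simple:
  assumes root: "poly D l = 0" and M: "\<exists>i j. poly (M i j) l \<noteq> 0"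
  shows "order l D = 1"
proof (rule ccontr)
  assume "order l D \<noteq> 1"
  moreover have "order l D \<noteq> 0"
    using order_root[THEN iffD1, OF root] char_poly_nonzero by blast
  ultimately have "2 \<le> order l D" by linarith
  then have "[:- l, 1:] ^ 2 dvd D"
    by (intro order_divides[THEN iffD2] disjI2)
  then obtain k where k: "D = [:- l, 1:] ^ 2 * k" by (rule dvdE)
  have D': "poly (pderiv D) l = 0"
    unfolding k power2_eq_square pderiv_mult poly_add poly_mult by simp
  from root have l: "Im l = 0" by (rule char_poly_root_real)
  from M obtain i j where ij: "poly (M i j) l \<noteq> 0" by blast
  have row: "bc_poly N e X r (M i 2) (- M i 1) \<in> {0, D, - D}" for r
    unfolding bc_poly_eq D_eq using exhaust_2[of i] exhaust_2[of r]
    by (elim disjE; simp only: insert_iff; simp add: mult.commute)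
  have 0: "poly (bc_poly N e X r (M i 2) (- M i 1)) l = 0" for r
    using row[of r] by (elim insertE emptyE; simp only: poly_0 poly_minus root minus_zero)
  have 1: "poly (pderiv (bc_poly N e X r (M i 2) (- M i 1))) l = 0" for r
    using row[of r] by (elim insertE emptyE; simp only: pderiv_0 pderiv_minus poly_0 poly_minus D' minus_zero)
  from bc_double_zero_imp_0[OF l 0 1] have "poly (M i 2) l = 0" "poly (M i 1) l = 0"
    by simp_all
  with ij exhaust_2[of j] show False by metis
qed

text \<open>Every entry has a factor \<open>[:- l, 1:]\<close>, which gives order at least 2. If the
  quotient matrix \<open>K\<close> were still singular at l, a kernel vector taken as constant
  initial values would produce boundary rows with a double zero, contrary to
  \<open>bc_double_zero_imp_0\<close>.\<close>

lemma order_char_poly_double: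
  assumes M: "\<And>i j. poly (M i j) l = 0"
  shows "order l D = 2"
proof -
  define K where "K i j = M i j div [:- l, 1:]" for i j
  have K: "M i j = [:- l, 1:] * K i j" for i j
    unfolding K_def by (rule dvd_mult_div_cancel[symmetric]) (use M[of i j] in \<open>simp add: poly_eq_0_iff_dvd\<close>)
  define D1 where "D1 = K 1 1 * K 2 2 - K 1 2 * K 2 1"
  have D: "D = [:- l, 1:] ^ 2 * D1"
    unfolding D_eq K D1_def by (simp only: power2_eq_square algebra_simps)
  have l: "Im l = 0" by (rule char_poly_root_real) (simp only: D poly_mult poly_power; simp)
  have "poly D1 l \<noteq> 0"
  proof
    assume "poly D1 l = 0"
    then have "poly (K 1 1) l * poly (K 2 2) l - poly (K 1 2) l * poly (K 2 1) l = 0"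
      by (simp add: D1_def)
    then obtain u v where uv: "\<not> (u = 0 \<and> v = 0)"
      "poly (K 1 1) l * u + poly (K 1 2) l * v = 0" "poly (K 2 1) l * u + poly (K 2 2) l * v = 0"
      by (rule det_eq_0_imp_kernel)
    have eq: "bc_poly N e X i [:u:] [:v:] = [:- l, 1:] * ([:u:] * K i 1 + [:v:] * K i 2)" for i
      unfolding bc_poly_eq K by (simp only: distrib_left mult.left_commute)
    have 0: "poly ([:u:] * K i 1 + [:v:] * K i 2) l = 0" for i
      using uv exhaust_2[of i] by (auto simp: mult.commute)
    have "poly (bc_poly N e X i [:u:] [:v:]) l = 0"
      "poly (pderiv (bc_poly N e X i [:u:] [:v:])) l = 0" for i
      unfolding eq pderiv_mult poly_add[of "_ * pderiv _"] poly_mult 0 by simp_all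
    from bc_double_zero_imp_0[OF l this] uv show False by simp
  qed
  then have "order l D1 = 0" by (rule order_0I)
  then show ?thesis
    using order_mult[OF char_poly_nonzero[unfolded D], of l] unfolding D order_power_n_n by linarith
qed

end

section \<open>Eigenspaces and multiplicities through the characteristic polynomial\<close>

lemma bc_class_eq: "bc_class X = (\<lambda>G. (G ** fst X, G ** snd X)) ` {G. invertible G}"
  by (auto simp: bc_class_def case_prod_beta)

lemma bc_class_self: "X \<in> bc_class X"
proof -
  have "invertible (mat 1 :: mat22)" unfolding invertible_def by (rule exI[of _ "mat 1"]) simp
  then show ?thesis unfolding bc_class_eq by (intro image_eqI[of _ _ "mat 1"]) simp_all
qed

lemma bc_class_annihilates_iff:
  "(\<forall>(A, B)\<in>bc_class X. A *v vector [a, b] + B *v vector [c, d] = 0) \<longleftrightarrow> (\<forall>i. bc_row X i a b c d = 0)"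
proof -
  have row: "(fst X *v vector [a, b] + snd X *v vector [c, d]) $ i = bc_row X i a b c d" for i
    by (simp add: matrix_vector_mult_def sum_2 bc_row_def)
  then have row0: "fst X *v vector [a, b] + snd X *v vector [c, d] = 0 \<longleftrightarrow> (\<forall>i. bc_row X i a b c d = 0)"
    by (simp add: vec_eq_iff)
  have "(\<forall>(A, B)\<in>bc_class X. A *v vector [a, b] + B *v vector [c, d] = 0) \<longleftrightarrow>
      fst X *v vector [a, b] + snd X *v vector [c, d] = 0"
  proof
    show "\<forall>(A, B)\<in>bc_class X. A *v vector [a, b] + B *v vector [c, d] = 0 \<Longrightarrow>
        fst X *v vector [a, b] + snd X *v vector [c, d] = 0"
      using bc_class_self[of X] by (auto simp: case_prod_beta)
  next
    assume h: "fst X *v vector [a, b] + snd X *v vector [c, d] = 0"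
    have "(G ** fst X) *v vector [a, b] + (G ** snd X) *v vector [c, d] = 0" for G :: mat22
      unfolding matrix_vector_mul_assoc[symmetric] matrix_vector_right_distrib[symmetric] h by simp
    then show "\<forall>(A, B)\<in>bc_class X. A *v vector [a, b] + B *v vector [c, d] = 0"
      by (auto simp: bc_class_eq)
  qed
  with row0 show ?thesis by simp
qed

context sl_representative
begin

text \<open>Cut off beyond \<open>N + 1\<close>, because the recursion runs on while vectors of
  \<open>eigenspace\<close> are zero there.\<close>

definition fund :: "complex poly \<Rightarrow> complex poly \<Rightarrow> complex \<Rightarrow> nat \<Rightarrow> complex"
  where "fund U V l n = (if n \<le> N + 1 then poly (solY e U V n) l else 0)"

abbreviation "eig_vec l u v \<equiv> (\<lambda>n. u * fund 1 0 l n + v * fund 0 1 l n)"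

lemma poly_sol_const:
  "poly (solY e [:u:] [:v:] n) l = u * poly (solY e 1 0 n) l + v * poly (solY e 0 1 n) l"
  "poly (solF e [:u:] [:v:] n) l = u * poly (solF e 1 0 n) l + v * poly (solF e 0 1 n) l"
  using sl_sol_linear[of e "[:u:]" "[:v:]" n] by (simp_all del: sl_sol.simps)

lemma fund_values:
  "fund 1 0 l 0 = 1" "fund 0 1 l 0 = 0" "fund 1 0 l 1 = 1" "fund 0 1 l 1 = of_real (g 0)"
  using N by (simp_all add: fund_def Let_def)

lemma eig_vec_eq_0_iff: "eig_vec l u v = (\<lambda>_. 0) \<longleftrightarrow> u = 0 \<and> v = 0"
proof
  assume h: "eig_vec l u v = (\<lambda>_. 0)"
  show "u = 0 \<and> v = 0"
    using fun_cong[OF h, of 0] fun_cong[OF h, of 1] g[of 0] unfolding fund_values by simp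
qed simp

text \<open>Initial values determine a solution, so the eigenspace is a copy of the kernel of the
  matrix \<open>M\<close> at l.\<close>

lemma eigenspace_eq:
  "eigenspace N (e, bc_class X) l =
    {eig_vec l u v | u v. \<forall>i. poly (M i 1) l * u + poly (M i 2) l * v = 0}"
proof (intro equalityI subsetI)
  fix y assume y: "y \<in> eigenspace N (e, bc_class X) l"
  define F where "F = (\<lambda>n. complex_of_real (1 / g n) * fwd_diff y n)"
  have y0: "y n = 0" if "n > N + 1" for n
    using y that by (simp add: eigenspace_def Let_def)
  have eq: "- bwd_diff F n + of_real (q n) * y n = l * of_real (w n) * y n" if "n \<in> {1..N}" for n
    using y that by (simp add: eigenspace_def Let_def F_def)
  have bc: "\<forall>(A, B)\<in>bc_class X. A *v vector [y 0, F 0] + B *v vector [y N, F N] = 0"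
    using y by (simp add: eigenspace_def Let_def F_def)
  have yS: "y (Suc n) = y n + of_real (g n) * F n" if "n \<le> N" for n
    using g[OF that] by (simp add: F_def fwd_diff_def)
  have FS: "F (Suc n) = F n + (of_real (q (Suc n)) - l * of_real (w (Suc n))) * y (Suc n)" if "n < N" for n
  proof -
    have "- (F (Suc n) - F n) + of_real (q (Suc n)) * y (Suc n) = l * of_real (w (Suc n)) * y (Suc n)"
      using eq[of "Suc n"] that by (simp add: bwd_diff_def)
    then show ?thesis by (simp add: algebra_simps)
  qed
  let ?U = "[:y 0:]" and ?V = "[:F 0:]"
  have sol: "y n = poly (solY e ?U ?V n) l \<and> F n = poly (solF e ?U ?V n) l" if "n \<le> N" for n
    using that
  proof (induction n)
    case (Suc n)
    then show ?case
      using yS[of n] FS[of n] unfolding sol_rec by simp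
  qed simp
  \<comment> \<open>The last component needs only the first half of the recursion; there is no
    equation at the index \<open>N + 1\<close>.\<close>
  have "y (Suc N) = poly (solY e ?U ?V (Suc N)) l"
    using yS[of N] sol[of N] unfolding sol_rec by simp
  then have sol': "y n = poly (solY e ?U ?V n) l" if "n \<le> N + 1" for n
    using that sol[of n] by (cases "n \<le> N") (auto simp: le_Suc_eq simp del: sl_sol.simps)
  have "y = eig_vec l (y 0) (F 0)"
  proof
    fix n show "y n = y 0 * fund 1 0 l n + F 0 * fund 0 1 l n"
      using y0[of n] sol'[of n] unfolding fund_def poly_sol_const by simp
  qed
  moreover have "poly (M i 1) l * y 0 + poly (M i 2) l * F 0 = 0" for i
  proof -
    have "poly (bc_poly N e X i ?U ?V) l = 0"
      unfolding poly_bc_poly using bc[unfolded bc_class_annihilates_iff] sol[of N] sol[of 0] by simp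
    then show ?thesis unfolding bc_poly_eq by (simp add: mult.commute)
  qed
  ultimately show "y \<in> {eig_vec l u v | u v. \<forall>i. poly (M i 1) l * u + poly (M i 2) l * v = 0}"
    by blast
next
  fix y assume "y \<in> {eig_vec l u v | u v. \<forall>i. poly (M i 1) l * u + poly (M i 2) l * v = 0}"
  then obtain u v where y: "y = eig_vec l u v" and uv: "\<And>i. poly (M i 1) l * u + poly (M i 2) l * v = 0"
    by blast
  let ?U = "[:u:]" and ?V = "[:v:]"
  define F where "F = (\<lambda>n. complex_of_real (1 / g n) * fwd_diff y n)"
  have yn: "y n = poly (solY e ?U ?V n) l" if "n \<le> N + 1" for n
    using that unfolding y poly_sol_const fund_def by simp
  have Fn: "F n = poly (solF e ?U ?V n) l" if "n \<le> N" for n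
  proof -
    have "y (n + 1) - y n = of_real (g n) * poly (solF e ?U ?V n) l"
      using yn[of n] yn[of "n + 1"] that sol_rec(1)[of ?U ?V n l] by simp
    then show ?thesis using g[OF that] by (simp add: F_def fwd_diff_def)
  qed
  have eq: "- bwd_diff F n + of_real (q n) * y n = l * of_real (w n) * y n" if "n \<in> {1..N}" for n
  proof -
    from that obtain k where k: "n = Suc k" "k < N" by (cases n) auto
    show ?thesis
      unfolding k bwd_diff_def
      using Fn[of "Suc k"] Fn[of k] yn[of "Suc k"] k sol_rec(2)[of ?U ?V k l]
      by (simp add: algebra_simps del: sl_sol.simps)
  qed
  have "poly (bc_poly N e X i ?U ?V) l = 0" for i
    using uv[of i] unfolding bc_poly_eq by (simp add: mult.commute)
  then have "\<forall>i. bc_row X i (y 0) (F 0) (y N) (F N) = 0"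
    unfolding poly_bc_poly using yn[of 0] yn[of N] Fn[of 0] Fn[of N] by (simp del: sl_sol.simps) simp
  then have "\<forall>(A, B)\<in>bc_class X. A *v vector [y 0, F 0] + B *v vector [y N, F N] = 0"
    unfolding bc_class_annihilates_iff .
  moreover have "\<forall>n>N + 1. y n = 0"
    by (simp add: y fund_def)
  ultimately show "y \<in> eigenspace N (e, bc_class X) l"
    using eq by (simp add: eigenspace_def Let_def F_def)
qed

lemma eigenvalues_eq: "eigenvalues N (e, bc_class X) = {l. poly D l = 0}"
proof -
  have "(\<exists>y\<in>eigenspace N (e, bc_class X) l. y \<noteq> (\<lambda>_. 0)) \<longleftrightarrow> poly D l = 0" for l
  proof
    assume "\<exists>y\<in>eigenspace N (e, bc_class X) l. y \<noteq> (\<lambda>_. 0)"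
    then obtain u v where uv: "\<not> (u = 0 \<and> v = 0)" "\<And>i. poly (M i 1) l * u + poly (M i 2) l * v = 0"
      unfolding eigenspace_eq by (auto simp: eig_vec_eq_0_iff)
    \<comment> \<open>Cramer's rule: the adjugate matrix applied to the homogeneous system.\<close>
    have "poly D l * u = poly (M 2 2) l * (poly (M 1 1) l * u + poly (M 1 2) l * v)
        - poly (M 1 2) l * (poly (M 2 1) l * u + poly (M 2 2) l * v)"
      unfolding D_eq by (simp add: algebra_simps)
    moreover have "poly D l * v = poly (M 1 1) l * (poly (M 2 1) l * u + poly (M 2 2) l * v)
        - poly (M 2 1) l * (poly (M 1 1) l * u + poly (M 1 2) l * v)"
      unfolding D_eq by (simp add: algebra_simps)
    ultimately show "poly D l = 0" using uv by auto
  next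
    assume "poly D l = 0"
    then have "poly (M 1 1) l * poly (M 2 2) l - poly (M 1 2) l * poly (M 2 1) l = 0"
      unfolding D_eq by simp
    then obtain u v where uv: "\<not> (u = 0 \<and> v = 0)"
      "poly (M 1 1) l * u + poly (M 1 2) l * v = 0" "poly (M 2 1) l * u + poly (M 2 2) l * v = 0"
      by (rule det_eq_0_imp_kernel)
    then have "poly (M i 1) l * u + poly (M i 2) l * v = 0" for i
      using exhaust_2[of i] by auto
    with uv(1) show "\<exists>y\<in>eigenspace N (e, bc_class X) l. y \<noteq> (\<lambda>_. 0)"
      unfolding eigenspace_eq by (intro bexI[of _ "eig_vec l u v"]) (auto simp: eig_vec_eq_0_iff)
  qed
  then show ?thesis unfolding eigenvalues_def by simp
qed

text \<open>The multiplicity is 2 minus the rank of \<open>M\<close> at l. Rank 2 means no root,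
  rank 0 and rank 1 are the double and the simple case treated above.\<close>

lemma eig_mult_eq_order: "eig_mult N (e, bc_class X) l = order l D"
proof (cases "poly D l = 0")
  case False
  have "eigenspace N (e, bc_class X) l \<subseteq> {0}"
    using False eigenvalues_eq unfolding eigenvalues_def by (auto simp: zero_fun_def)
  then have "seq_dim (eigenspace N (e, bc_class X) l) = 0"
    by (intro seq.dim_unique[of "{}"]) (auto simp: seq.independent_empty)
  moreover have "order l D = 0" using False by (rule order_0I)
  ultimately show ?thesis by (simp add: eig_mult_def)
next
  case True
  show ?thesis
  proof (cases "\<forall>i j. poly (M i j) l = 0")
    case True
    let ?E = "fund 1 0 l" and ?E' = "fund 0 1 l"
    have E: "?E = eig_vec l 1 0" "?E' = eig_vec l 0 1" by (simp_all add: fun_eq_iff)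
    have V: "eigenspace N (e, bc_class X) l = {eig_vec l u v | u v. True}"
      unfolding eigenspace_eq using True by simp
    have ne: "?E \<noteq> ?E'" by (rule notI, drule fun_cong[of _ _ 0]) (simp add: fund_values)
    have "?E' \<noteq> 0"
      using eig_vec_eq_0_iff[of 0 l 1] by (simp add: zero_fun_def)
    moreover have "?E \<notin> seq.span {?E'}"
      unfolding seq.span_singleton using fund_values(1,2)[of l] by (auto dest: fun_cong[of _ _ 0])
    ultimately have ind: "seq.independent {?E, ?E'}"
      using ne by (simp add: seq.independent_insert seq.independent_empty)
    have "eig_vec l u v \<in> seq.span {?E, ?E'}" for u v
    proof -
      have "(\<lambda>n. u * ?E n) + (\<lambda>n. v * ?E' n) \<in> seq.span {?E, ?E'}"
        by (intro seq.span_add seq.span_scale seq.span_base) auto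
      then show ?thesis by (simp add: plus_fun_def)
    qed
    then have "eigenspace N (e, bc_class X) l \<subseteq> seq.span {?E, ?E'}" unfolding V by blast
    moreover have "{?E, ?E'} \<subseteq> eigenspace N (e, bc_class X) l"
      unfolding V using E by blast
    ultimately have "seq_dim (eigenspace N (e, bc_class X) l) = 2"
      using ind ne by (intro seq.dim_unique[of "{?E, ?E'}"]) auto
    with True show ?thesis
      using order_char_poly_double unfolding eig_mult_def by simp
  next
    case False
    then obtain i j where "poly (M i j) l \<noteq> 0" by blast
    then have ij: "poly (M i 1) l \<noteq> 0 \<or> poly (M i 2) l \<noteq> 0"
      using exhaust_2[of j] by auto
    define a b where "a = poly (M i 1) l" and "b = poly (M i 2) l"
    have ab: "a \<noteq> 0 \<or> b \<noteq> 0" using ij by (simp add: a_def b_def)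
    \<comment> \<open>The row (a, b) is nonzero and the determinant vanishes, so the kernel is the
      line spanned by (b, - a).\<close>
    let ?x = "eig_vec l b (- a)"
    have "poly (M 1 1) l * poly (M 2 2) l - poly (M 1 2) l * poly (M 2 1) l = 0"
      using \<open>poly D l = 0\<close> unfolding D_eq by simp
    then have "poly (M r 1) l * b + poly (M r 2) l * (- a) = 0" for r
      unfolding a_def b_def using exhaust_2[of i] exhaust_2[of r] by (auto simp: algebra_simps)
    then have x: "?x \<in> eigenspace N (e, bc_class X) l"
      unfolding eigenspace_eq by blast
    have "?x \<noteq> 0"
      using ab eig_vec_eq_0_iff[of b l "- a"] by (auto simp: zero_fun_def)
    then have ind: "seq.independent {?x}"
      by (simp add: seq.independent_insert seq.independent_empty)
    have "\<exists>k. u = k * b \<and> v = k * (- a)" if "a * u + b * v = 0" for u v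
    proof (cases "b = 0")
      case True
      with ab that show ?thesis by (intro exI[of _ "- v / a"]) auto
    next
      case False
      have "v = - (a * u) / b"
        using that False by (simp add: field_simps eq_neg_iff_add_eq_0 add.commute)
      with False show ?thesis by (intro exI[of _ "u / b"]) (auto simp: field_simps)
    qed
    then have "\<exists>k. eig_vec l u v = (\<lambda>n. k * ?x n)" if "a * u + b * v = 0" for u v
      using that by (fastforce simp: algebra_simps)
    then have "eigenspace N (e, bc_class X) l \<subseteq> seq.span {?x}"
      unfolding eigenspace_eq seq.span_singleton a_def b_def by blast
    then have "seq_dim (eigenspace N (e, bc_class X) l) = 1"
      using ind x by (intro seq.dim_unique[of "{?x}"]) auto
    with order_char_poly_simple[OF \<open>poly D l = 0\<close>] False show ?thesis
      unfolding eig_mult_def by simp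
  qed
qed

end

section \<open>Counting roots of real-rooted polynomials\<close>

lemma prod_mset_nonneg:
  fixes f :: "'a \<Rightarrow> real"
  assumes "\<And>r. 0 \<le> f r"
  shows "0 \<le> (\<Prod>r\<in>#R. f r)"
  by (induction R) (simp_all add: assms)

lemma norm_poly_eq_prod_roots:
  "cmod (poly p z) = cmod (lead_coeff p) * (\<Prod>r\<in>#proots p. cmod (z - r))"
proof -
  have "cmod (poly (\<Prod>r\<in>#R. [:- r, 1:]) z) = (\<Prod>r\<in>#R. cmod (z - r))" for R
  proof (induction R)
    case (add r R)
    show ?case
      unfolding image_mset_add_mset prod_mset.add_mset poly_mult norm_mult add by simp
  qed simp
  then show ?thesis
    by (subst complex_poly_decompose_multiset[symmetric]) (simp only: poly_smult norm_mult)
qed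

lemma cmod_real_shift:
  assumes "Im r = 0"
  shows "(cmod (of_real x + \<i> * of_real d - r))\<^sup>2 = (x - Re r)\<^sup>2 + d\<^sup>2"
    and "cmod (r - of_real x) = \<bar>x - Re r\<bar>"
  using assms by (simp_all add: cmod_power2 cmod_eq_Re abs_minus_commute)

text \<open>One root at a time: passing from height d to e multiplies the distance to a real root by
  at most e/d, and by at most 2 if the root is at distance e or more. The 2 is granted to every
  root, so that its exponent is the total number of roots.\<close>

lemma prod_shift_le:
  assumes "0 < d" "d \<le> e" and "\<And>r. r \<in># R \<Longrightarrow> Im r = 0"
  shows "(\<Prod>r\<in>#R. cmod (of_real x + \<i> * of_real e - r)) \<le>
    (e / d) ^ size {#r \<in># R. cmod (r - of_real x) < e#} * 2 ^ size R *
    (\<Prod>r\<in>#R. cmod (of_real x + \<i> * of_real d - r))"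
  using assms(3)
proof (induction R)
  case (add r R)
  define a b where "a = cmod (of_real x + \<i> * of_real d - r)" and "b = cmod (of_real x + \<i> * of_real e - r)"
  define c where "c = (if cmod (r - of_real x) < e then e / d else 1)"
  have r: "Im r = 0" using add.prems by simp
  have a2: "a\<^sup>2 = (x - Re r)\<^sup>2 + d\<^sup>2" and b2: "b\<^sup>2 = (x - Re r)\<^sup>2 + e\<^sup>2"
    unfolding a_def b_def using cmod_real_shift(1)[OF r] by simp_all
  have "b \<le> c * 2 * a"
  proof (rule power2_le_imp_le)
    show "b\<^sup>2 \<le> (c * 2 * a)\<^sup>2"
    proof (cases "cmod (r - of_real x) < e")
      case True
      have "(x - Re r)\<^sup>2 * d\<^sup>2 \<le> (x - Re r)\<^sup>2 * e\<^sup>2"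
        using assms by (intro mult_left_mono power_mono) auto
      then have "b\<^sup>2 * d\<^sup>2 \<le> e\<^sup>2 * a\<^sup>2"
        unfolding a2 b2 by (simp add: algebra_simps)
      moreover have "0 \<le> e\<^sup>2 * a\<^sup>2" by simp
      ultimately have "b\<^sup>2 * d\<^sup>2 \<le> 4 * (e\<^sup>2 * a\<^sup>2)" by linarith
      then show ?thesis
        using True assms by (simp add: c_def field_simps power2_eq_square)
    next
      case False
      then have "e \<le> \<bar>x - Re r\<bar>" using cmod_real_shift(2)[OF r] by simp
      then have "e\<^sup>2 \<le> (x - Re r)\<^sup>2" using assms by (metis abs_le_square_iff abs_of_nonneg less_eq_real_def order_trans)
      moreover have "0 \<le> (x - Re r)\<^sup>2" "0 \<le> d\<^sup>2" by simp_all
      ultimately have "b\<^sup>2 \<le> 4 * a\<^sup>2"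
        unfolding a2 b2 distrib_left by linarith
      then show ?thesis using False by (simp add: c_def power_mult_distrib)
    qed
    show "0 \<le> c * 2 * a" using assms by (auto simp: c_def a_def)
  qed
  moreover have "(\<Prod>r\<in>#R. cmod (of_real x + \<i> * of_real e - r)) \<le>
    (e / d) ^ size {#r \<in># R. cmod (r - of_real x) < e#} * 2 ^ size R *
    (\<Prod>r\<in>#R. cmod (of_real x + \<i> * of_real d - r))" (is "?B \<le> ?K * 2 ^ size R * ?A")
    using add by simp
  moreover have "0 \<le> ?B" by (intro prod_mset_nonneg) auto
  moreover have "0 \<le> c * 2 * a" using assms by (auto simp: c_def a_def)
  ultimately have "b * ?B \<le> (c * 2 * a) * (?K * 2 ^ size R * ?A)"
    by (intro mult_mono)
  moreover have "(e / d) ^ size {#s \<in># add_mset r R. cmod (s - of_real x) < e#} = c * ?K"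
    by (simp add: c_def)
  ultimately show ?case
    by (simp add: a_def b_def mult_ac)
qed simp

lemma real_rooted_poly_shift_le:
  assumes "0 < d" "d \<le> e" and "\<And>r. poly p r = 0 \<Longrightarrow> Im r = 0" and "p \<noteq> 0"
  shows "cmod (poly p (of_real x + \<i> * of_real e)) \<le>
    (e / d) ^ size {#r \<in># proots p. cmod (r - of_real x) < e#} * 2 ^ degree p *
    cmod (poly p (of_real x + \<i> * of_real d))"
proof -
  have "Im r = 0" if "r \<in># proots p" for r
    using that assms(3,4) by simp
  from mult_left_mono[OF prod_shift_le[OF assms(1,2) this, of "proots p" x], of "cmod (lead_coeff p)"]
  show ?thesis
    unfolding norm_poly_eq_prod_roots size_proots_complex by (simp add: mult_ac)
qed

text \<open>The roots of a real-rooted polynomial near a real point are counted by comparing the moduli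
  at two points above it. A bound on the degree suffices, so the criterion is stable under
  perturbations that change the degree.\<close>

lemma real_rooted_count_roots_ge:
  assumes "0 < d" "d \<le> e" and rr: "\<And>r. poly p r = 0 \<Longrightarrow> Im r = 0" and "p \<noteq> 0" and deg: "degree p \<le> K"
    and less: "(e / d) ^ n * 2 ^ K * cmod (poly p (of_real x + \<i> * of_real d)) <
      cmod (poly p (of_real x + \<i> * of_real e))"
  shows "n < size {#r \<in># proots p. cmod (r - of_real x) < e#}"
proof (rule ccontr)
  assume "\<not> ?thesis"
  then have "(e / d) ^ size {#r \<in># proots p. cmod (r - of_real x) < e#} \<le> (e / d) ^ n"
    using assms by (intro power_increasing) auto
  moreover have "(2::real) ^ degree p \<le> 2 ^ K" using deg by simp
  ultimately have "(e / d) ^ size {#r \<in># proots p. cmod (r - of_real x) < e#} * 2 ^ degree p *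
      cmod (poly p (of_real x + \<i> * of_real d)) \<le> (e / d) ^ n * 2 ^ K * cmod (poly p (of_real x + \<i> * of_real d))"
    using assms by (intro mult_mono) auto
  with real_rooted_poly_shift_le[OF assms(1-4), of x] less show False by linarith
qed

text \<open>Converse direction: at a root of order above n the modulus at height d is of size
  d^(n+1), which beats (e/d)^n times any constant as d tends to 0.\<close>

lemma multiple_root_shift_less:
  assumes "n < order (of_real x) p" "0 < e" "poly p (of_real x + \<i> * of_real e) \<noteq> 0"
  obtains d where "0 < d" "d \<le> e"
    "(e / d) ^ n * 2 ^ K * cmod (poly p (of_real x + \<i> * of_real d)) < cmod (poly p (of_real x + \<i> * of_real e))"
proof -
  have "[:- of_real x, 1:] ^ Suc n dvd p"
    using assms(1) by (intro order_divides[THEN iffD2] disjI2) simp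
  then obtain k where k: "p = [:- of_real x, 1:] ^ Suc n * k" by (rule dvdE)
  have p: "cmod (poly p (of_real x + \<i> * of_real d)) = d ^ Suc n * cmod (poly k (of_real x + \<i> * of_real d))" if "0 < d" for d
    unfolding k poly_mult poly_power using that by (simp add: norm_mult norm_power)
  have "((\<lambda>d. d * (e ^ n * 2 ^ K * cmod (poly k (of_real x + \<i> * of_real d)))) \<longlongrightarrow>
      0 * (e ^ n * 2 ^ K * cmod (poly k (of_real x + \<i> * of_real 0)))) (at_right 0)"
    by (intro tendsto_intros)
  then have "((\<lambda>d. d * (e ^ n * 2 ^ K * cmod (poly k (of_real x + \<i> * of_real d)))) \<longlongrightarrow> 0) (at_right 0)"
    by simp
  then have "eventually (\<lambda>d. d * (e ^ n * 2 ^ K * cmod (poly k (of_real x + \<i> * of_real d))) <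
      cmod (poly p (of_real x + \<i> * of_real e))) (at_right 0)"
    by (rule order_tendstoD) (use assms in simp)
  moreover have "eventually (\<lambda>d. d \<in> {0<..<e}) (at_right 0)"
    using assms by (intro eventually_at_right_real) auto
  ultimately have "eventually (\<lambda>d. 0 < d \<and> d \<le> e \<and> (e / d) ^ n * 2 ^ K * cmod (poly p (of_real x + \<i> * of_real d))
      < cmod (poly p (of_real x + \<i> * of_real e))) (at_right 0)"
  proof eventually_elim
    case (elim d)
    then show ?case using p[of d] by (simp add: field_simps power_divide)
  qed
  then obtain d where "0 < d \<and> d \<le> e \<and> (e / d) ^ n * 2 ^ K * cmod (poly p (of_real x + \<i> * of_real d))
      < cmod (poly p (of_real x + \<i> * of_real e))"
    using eventually_happens' trivial_limit_at_right_real by blast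
  then show ?thesis using that by blast
qed

text \<open>Moving from x to x + \<i> shortens no distance to a real root, and the new distances are
  at least 1. A root within d of x therefore gives |p(x)| \<le> d |p(x + \<i>)|, whatever the
  degree.\<close>

lemma real_rooted_no_root_near:
  assumes rr: "\<And>r. poly p r = 0 \<Longrightarrow> Im r = 0" and "p \<noteq> 0"
    and less: "d * cmod (poly p (of_real x + \<i>)) < cmod (poly p (of_real x))"
    and "poly p r = 0"
  shows "d < cmod (r - of_real x)"
proof (rule ccontr)
  assume "\<not> ?thesis"
  then have d: "cmod (of_real x - r) \<le> d" by (simp add: norm_minus_commute)
  have le: "cmod (of_real x - s) \<le> cmod (of_real x + \<i> - s)" "1 \<le> cmod (of_real x + \<i> - s)" if "Im s = 0" for s
    using that abs_Re_le_cmod[of "of_real x + \<i> - s"] abs_Im_le_cmod[of "of_real x + \<i> - s"]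
    by (simp_all add: cmod_eq_Re)
  have prod_le: "(\<Prod>s\<in>#R. cmod (of_real x - s)) \<le> (\<Prod>s\<in>#R. cmod (of_real x + \<i> - s))"
    if "\<And>s. s \<in># R \<Longrightarrow> Im s = 0" for R
    using that
  proof (induction R)
    case (add s R)
    then show ?case
      by (auto intro!: mult_mono le prod_mset_nonneg)
  qed simp
  have "r \<in># proots p" using assms by simp
  then obtain R where R: "proots p = add_mset r R" by (metis multi_member_split)
  have real: "Im s = 0" if "s \<in># proots p" for s using that rr \<open>p \<noteq> 0\<close> by simp
  have "0 \<le> d" using d norm_ge_zero order_trans by blast
  have "cmod (of_real x - r) * (\<Prod>s\<in>#R. cmod (of_real x - s)) \<le> d * (\<Prod>s\<in>#R. cmod (of_real x + \<i> - s))"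
    using d \<open>0 \<le> d\<close> real R by (intro mult_mono prod_le) (auto intro: prod_mset_nonneg)
  also have "\<dots> \<le> d * (cmod (of_real x + \<i> - r) * (\<Prod>s\<in>#R. cmod (of_real x + \<i> - s)))"
    using \<open>0 \<le> d\<close> mult_right_mono[OF le(2)[of r] prod_mset_nonneg[of "\<lambda>s. cmod (of_real x + \<i> - s)" R]] real R
    by (intro mult_left_mono) auto
  finally have "cmod (lead_coeff p) * (cmod (of_real x - r) * (\<Prod>s\<in>#R. cmod (of_real x - s))) \<le>
      cmod (lead_coeff p) * (d * (cmod (of_real x + \<i> - r) * (\<Prod>s\<in>#R. cmod (of_real x + \<i> - s))))"
    by (intro mult_left_mono) auto
  with less show False
    unfolding norm_poly_eq_prod_roots R by (simp add: mult_ac)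
qed

section \<open>Passing to representatives of boundary conditions\<close>

lemma rank2_matrices_mult:
  assumes "(A, B) \<in> rank2_matrices" and "invertible G"
  shows "(G ** A, G ** B) \<in> rank2_matrices"
  unfolding rank2_matrices_iff
proof (intro allI impI)
  fix a b
  assume h: "\<forall>j. a * (G ** A) $ 1 $ j + b * (G ** A) $ 2 $ j = 0 \<and> a * (G ** B) $ 1 $ j + b * (G ** B) $ 2 $ j = 0"
  \<comment> \<open>(\<open>?a\<close>, \<open>?b\<close>) is the row vector (a, b) times G.
    Independence of the original rows makes it zero, and the inverse matrix recovers a = b =
    0.\<close>
  let ?a = "a * G $ 1 $ 1 + b * G $ 2 $ 1" and ?b = "a * G $ 1 $ 2 + b * G $ 2 $ 2"
  have "?a * C $ 1 $ j + ?b * C $ 2 $ j = a * (G ** C) $ 1 $ j + b * (G ** C) $ 2 $ j" for C :: mat22 and j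
    by (simp add: matrix_matrix_mult_def sum_2 algebra_simps)
  with h have 0: "?a = 0" "?b = 0"
    using assms(1)[unfolded rank2_matrices_iff, rule_format, of ?a ?b] by simp_all
  obtain H where "G ** H = mat 1"
    using assms(2) unfolding invertible_def by blast
  then have "(G ** H) $ i $ j = (if i = j then 1 else 0)" for i j by (simp add: mat_def)
  from this[of 1 1] this[of 1 2] this[of 2 1] this[of 2 2]
  have GH: "G $ 1 $ 1 * H $ 1 $ 1 + G $ 1 $ 2 * H $ 2 $ 1 = 1" "G $ 1 $ 1 * H $ 1 $ 2 + G $ 1 $ 2 * H $ 2 $ 2 = 0"
    "G $ 2 $ 1 * H $ 1 $ 1 + G $ 2 $ 2 * H $ 2 $ 1 = 0" "G $ 2 $ 1 * H $ 1 $ 2 + G $ 2 $ 2 * H $ 2 $ 2 = 1"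
    by (simp_all add: matrix_matrix_mult_def sum_2)
  have "a = a * (G $ 1 $ 1 * H $ 1 $ 1 + G $ 1 $ 2 * H $ 2 $ 1) + b * (G $ 2 $ 1 * H $ 1 $ 1 + G $ 2 $ 2 * H $ 2 $ 1)"
    unfolding GH by simp
  also have "\<dots> = ?a * H $ 1 $ 1 + ?b * H $ 2 $ 1" by (simp add: algebra_simps)
  finally have "a = 0" unfolding 0 by simp
  moreover have "b = a * (G $ 1 $ 1 * H $ 1 $ 2 + G $ 1 $ 2 * H $ 2 $ 2) + b * (G $ 2 $ 1 * H $ 1 $ 2 + G $ 2 $ 2 * H $ 2 $ 2)"
    unfolding GH by simp
  then have "b = ?a * H $ 1 $ 2 + ?b * H $ 2 $ 2" by (simp add: algebra_simps)
  then have "b = 0" unfolding 0 by simp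
  ultimately show "a = 0 \<and> b = 0" ..
qed

lemma ctranspose_mult: "ctranspose (G ** A) = ctranspose A ** ctranspose G"
  by (simp add: ctranspose_def matrix_matrix_mult_def vec_eq_iff mult.commute)

lemma selfadjoint_matrices_mult:
  assumes "(A, B) \<in> selfadjoint_matrices" and "invertible G"
  shows "(G ** A, G ** B) \<in> selfadjoint_matrices"
proof -
  have "(G ** C) ** Jmat ** ctranspose (G ** C) = G ** (C ** Jmat ** ctranspose C) ** ctranspose G" for C
    by (simp add: ctranspose_mult matrix_mul_assoc)
  with assms rank2_matrices_mult show ?thesis
    by (auto simp: selfadjoint_matrices_def)
qed

lemma invertible_obtain_inverse:
  fixes G :: mat22
  assumes "invertible G"
  obtains H where "invertible H" "\<And>C :: mat22. H ** (G ** C) = C"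
proof -
  obtain H where H: "G ** H = mat 1" "H ** G = mat 1"
    using assms unfolding invertible_def by blast
  then have "invertible H" unfolding invertible_def by blast
  moreover have "H ** (G ** C) = C" for C :: mat22
    unfolding matrix_mul_assoc H by simp
  ultimately show ?thesis using that by blast
qed

lemma bc_class_eq_imp:
  assumes "bc_class X = bc_class Y"
  obtains G where "invertible G" "Y = (G ** fst X, G ** snd X)"
  using bc_class_self[of Y] assms unfolding bc_class_eq by auto

lemma bc_class_mult:
  assumes "invertible G"
  shows "bc_class (G ** fst X, G ** snd X) = bc_class X"
proof -
  obtain H where H: "invertible H" "\<And>C :: mat22. H ** (G ** C) = C"
    using invertible_obtain_inverse[OF assms] by blast
  have "bc_class (G ** fst X, G ** snd X) \<subseteq> bc_class X" if "invertible G" for G X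
  proof
    fix Z assume "Z \<in> bc_class (G ** fst X, G ** snd X)"
    then obtain K where "invertible K" "Z = (K ** (G ** fst X), K ** (G ** snd X))"
      unfolding bc_class_eq by auto
    then show "Z \<in> bc_class X"
      using that unfolding bc_class_eq
      by (intro image_eqI[of _ _ "K ** G"]) (simp_all add: matrix_mul_assoc invertible_mult)
  qed
  from this[OF assms, of X] this[OF H(1), of "(G ** fst X, G ** snd X)"] show ?thesis
    by (simp add: H(2))
qed

text \<open>The saturation of an open set is the union of its preimages under left multiplication by
  invertible matrices, hence open. Self-adjointness is invariant under these multiplications, so
  restricting to self-adjoint pairs before or after taking classes gives the same image.\<close>

lemma open_map_bc_class:
  "open_map (top_of_set selfadjoint_matrices) bc_space bc_class"
  unfolding open_map_def
proof (intro allI impI)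
  fix V assume "openin (top_of_set selfadjoint_matrices) V"
  then obtain T where T: "open T" "V = selfadjoint_matrices \<inter> T"
    by (auto simp: openin_open)
  let ?W = "bc_class ` (rank2_matrices \<inter> T)"
  let ?Q = "quotient_topology_of (top_of_set rank2_matrices) bc_class"
  have "openin ?Q ?W"
    unfolding openin_quotient_topology_of
  proof (intro conjI)
    show "?W \<subseteq> bc_class ` topspace (top_of_set rank2_matrices)" by auto
    have eq: "{X \<in> topspace (top_of_set rank2_matrices). bc_class X \<in> ?W} =
        rank2_matrices \<inter> (\<Union>G\<in>{G. invertible G}. (\<lambda>X. (G ** fst X, G ** snd X)) -` T)"
    proof (intro equalityI subsetI)
      fix X assume "X \<in> {X \<in> topspace (top_of_set rank2_matrices). bc_class X \<in> ?W}"
      then obtain Y where X: "X \<in> rank2_matrices" "bc_class X = bc_class Y" "Y \<in> T" by auto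
      from X(2) obtain G where "invertible G" "Y = (G ** fst X, G ** snd X)"
        by (rule bc_class_eq_imp)
      with X show "X \<in> rank2_matrices \<inter> (\<Union>G\<in>{G. invertible G}. (\<lambda>X. (G ** fst X, G ** snd X)) -` T)"
        by auto
    next
      fix X assume "X \<in> rank2_matrices \<inter> (\<Union>G\<in>{G. invertible G}. (\<lambda>X. (G ** fst X, G ** snd X)) -` T)"
      then obtain G where G: "X \<in> rank2_matrices" "invertible G" "(G ** fst X, G ** snd X) \<in> T" by auto
      then have "(G ** fst X, G ** snd X) \<in> rank2_matrices \<inter> T"
        using rank2_matrices_mult[of "fst X" "snd X" G] by simp
      then have "bc_class X \<in> ?W"
        using bc_class_mult[OF G(2), of X] by (metis imageI)
      with G show "X \<in> {X \<in> topspace (top_of_set rank2_matrices). bc_class X \<in> ?W}" by simp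
    qed
    have "open ((\<lambda>X. (G ** fst X, G ** snd X)) -` T)" for G :: mat22
    proof (rule open_vimage[OF T(1)])
      have cont: "continuous_on UNIV (\<lambda>A. G ** f A)" if "continuous_on UNIV f" for f :: "mat22 \<times> mat22 \<Rightarrow> mat22"
        unfolding matrix_matrix_mult_def
        by (intro continuous_intros continuous_on_vec_lambda continuous_on_sum that)
      show "continuous_on UNIV (\<lambda>X :: mat22 \<times> mat22. (G ** fst X, G ** snd X))"
        by (intro continuous_on_Pair cont continuous_on_fst continuous_on_snd continuous_on_id)
    qed
    then show "openin (top_of_set rank2_matrices) {X \<in> topspace (top_of_set rank2_matrices). bc_class X \<in> ?W}"
      unfolding eq by (intro openin_open_Int open_UN) auto
  qed
  moreover have "bc_class ` V = ?W \<inter> bc_class ` selfadjoint_matrices"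
  proof (intro equalityI subsetI)
    fix c assume "c \<in> bc_class ` V"
    then show "c \<in> ?W \<inter> bc_class ` selfadjoint_matrices"
      unfolding T by (auto simp: selfadjoint_matrices_def)
  next
    fix c assume "c \<in> ?W \<inter> bc_class ` selfadjoint_matrices"
    then obtain X Y where XY: "c = bc_class X" "X \<in> T" "bc_class Y = bc_class X" "Y \<in> selfadjoint_matrices"
      by blast
    then obtain G where "invertible G" "X = (G ** fst Y, G ** snd Y)"
      using bc_class_eq_imp by blast
    then have "X \<in> selfadjoint_matrices"
      using XY selfadjoint_matrices_mult[of "fst Y" "snd Y" G] by simp
    with XY show "c \<in> bc_class ` V" unfolding T by blast
  qed
  ultimately show "openin bc_space (bc_class ` V)"
    unfolding bc_space_def openin_subtopology by blast
qed

lemma topspace_bc_space: "topspace bc_space = bc_class ` selfadjoint_matrices"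
  unfolding bc_space_def topspace_subtopology topspace_quotient_topology_of
  by (auto simp: selfadjoint_matrices_def)

text \<open>The space on which the characteristic polynomial lives; \<open>slp_of\<close> projects
  it onto the problems.\<close>

definition rep_space :: "nat \<Rightarrow> (sl_equation \<times> (mat22 \<times> mat22)) topology"
  where "rep_space N = prod_topology (eq_space N) (top_of_set selfadjoint_matrices)"

definition slp_of :: "sl_equation \<times> (mat22 \<times> mat22) \<Rightarrow> sl_problem"
  where "slp_of x = (fst x, bc_class (snd x))"

lemma open_map_slp_of: "open_map (rep_space N) (slp_space N) slp_of"
  unfolding open_map_def
proof (intro allI impI)
  fix W assume W: "openin (rep_space N) W"
  show "openin (slp_space N) (slp_of ` W)"
    unfolding slp_space_def openin_prod_topology_alt
  proof (intro allI impI)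
    fix e c assume "(e, c) \<in> slp_of ` W"
    then obtain X where X: "(e, X) \<in> W" "c = bc_class X" by (auto simp: slp_of_def)
    then obtain U V where UV: "openin (eq_space N) U" "openin (top_of_set selfadjoint_matrices) V"
      "e \<in> U" "X \<in> V" "U \<times> V \<subseteq> W"
      using W unfolding rep_space_def openin_prod_topology_alt by meson
    have "openin bc_space (bc_class ` V)"
      using open_map_bc_class UV(2) unfolding open_map_def by blast
    moreover have "U \<times> bc_class ` V \<subseteq> slp_of ` W"
    proof
      fix z assume "z \<in> U \<times> bc_class ` V"
      then obtain e' X' where "z = slp_of (e', X')" "e' \<in> U" "X' \<in> V" by (auto simp: slp_of_def)
      with UV(5) show "z \<in> slp_of ` W" by blast
    qed
    ultimately show "\<exists>U V. openin (eq_space N) U \<and> openin bc_space V \<and> e \<in> U \<and> c \<in> V \<and> U \<times> V \<subseteq> slp_of ` W"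
      using UV X by blast
  qed
qed

lemma topspace_slp_space: "topspace (slp_space N) = slp_of ` topspace (rep_space N)"
proof (intro equalityI subsetI)
  fix P assume "P \<in> topspace (slp_space N)"
  then obtain e c where P: "P = (e, c)" "e \<in> topspace (eq_space N)" "c \<in> topspace bc_space"
    unfolding slp_space_def by auto
  then obtain X where "X \<in> selfadjoint_matrices" "c = bc_class X"
    unfolding topspace_bc_space by blast
  with P show "P \<in> slp_of ` topspace (rep_space N)"
    by (intro image_eqI[of _ _ "(e, X)"]) (auto simp: rep_space_def slp_of_def)
next
  fix P assume "P \<in> slp_of ` topspace (rep_space N)"
  then show "P \<in> topspace (slp_space N)"
    by (auto simp: slp_space_def rep_space_def slp_of_def topspace_bc_space)
qed

text \<open>Transfers an open condition on representatives to problems. One representative with Q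
  for each nearby problem is enough, since the spectrum depends only on the class. The filter
  \<open>atin\<close> leaves out the point itself, hence the separate premise
  \<open>Q x\<close>.\<close>

lemma slp_space_neighbourhood:
  assumes x: "x \<in> topspace (rep_space N)" and "eventually Q (atin (rep_space N) x)" and "Q x"
  obtains U where "openin (slp_space N) U" "slp_of x \<in> U"
    "\<And>P. P \<in> U \<Longrightarrow> \<exists>y\<in>topspace (rep_space N). P = slp_of y \<and> Q y"
proof -
  obtain W where W: "openin (rep_space N) W" "x \<in> W" "\<forall>y\<in>W - {x}. Q y"
    using assms(1,2) unfolding eventually_atin by blast
  show ?thesis
  proof (rule that)
    show "openin (slp_space N) (slp_of ` W)"
      using open_map_slp_of W(1) unfolding open_map_def by blast
    show "slp_of x \<in> slp_of ` W" using W(2) by blast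
    show "\<exists>y\<in>topspace (rep_space N). P = slp_of y \<and> Q y" if "P \<in> slp_of ` W" for P
      using that W \<open>Q x\<close> openin_subset[OF W(1)] by blast
  qed
qed

section \<open>Continuity of the characteristic polynomial\<close>

lemma tendsto_atin_if_continuous_map:
  assumes "continuous_map X euclidean f" "x \<in> topspace X"
  shows "(f \<longlongrightarrow> f x) (atin X x)"
  using assms unfolding continuous_map_atin by simp

lemma eq_space_continuous:
  shows "n \<le> N \<Longrightarrow> continuous_map (eq_space N) euclideanreal (\<lambda>e. fst e n)"
    and "1 \<le> n \<Longrightarrow> n \<le> N \<Longrightarrow> continuous_map (eq_space N) euclideanreal (\<lambda>e. fst (snd e) n)"
    and "1 \<le> n \<Longrightarrow> n \<le> N \<Longrightarrow> continuous_map (eq_space N) euclideanreal (\<lambda>e. snd (snd e) n)"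
proof -
  let ?A = "product_topology (\<lambda>_. euclideanreal) {0..N}" and ?B = "product_topology (\<lambda>_. euclideanreal) {1..N}"
  let ?P = "prod_topology ?A (prod_topology ?B ?B)"
  have proj: "continuous_map ?P euclideanreal (\<lambda>e. f e n)"
    if "continuous_map ?P (product_topology (\<lambda>_. euclideanreal) I) f" "n \<in> I" for f I n
    using continuous_map_compose[OF that(1) continuous_map_product_projection[OF that(2)]] by (simp add: o_def)
  have snd: "continuous_map ?P ?B (\<lambda>e. fst (snd e))" "continuous_map ?P ?B (\<lambda>e. snd (snd e))"
    using continuous_map_compose[OF continuous_map_snd continuous_map_fst]
      continuous_map_compose[OF continuous_map_snd continuous_map_snd] by (auto simp: o_def)
  show "continuous_map (eq_space N) euclideanreal (\<lambda>e. fst e n)" if "n \<le> N"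
    unfolding eq_space_def
    by (rule continuous_map_from_subtopology, rule proj[OF continuous_map_fst]) (use that in auto)
  show "continuous_map (eq_space N) euclideanreal (\<lambda>e. fst (snd e) n)" if "1 \<le> n" "n \<le> N"
    unfolding eq_space_def
    by (rule continuous_map_from_subtopology, rule proj[OF snd(1)]) (use that in auto)
  show "continuous_map (eq_space N) euclideanreal (\<lambda>e. snd (snd e) n)" if "1 \<le> n" "n \<le> N"
    unfolding eq_space_def
    by (rule continuous_map_from_subtopology, rule proj[OF snd(2)]) (use that in auto)
qed

text \<open>Convergence at a fixed point z suffices, because the criteria for roots compare values
  at two points only.\<close>

lemma tendsto_char_poly:
  assumes x: "x \<in> topspace (rep_space N)"
  shows "((\<lambda>y. poly (char_poly N (fst y) (snd y)) z) \<longlongrightarrow> poly (char_poly N (fst x) (snd x)) z) (atin (rep_space N) x)"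
proof -
  let ?F = "atin (rep_space N) x"
  have comp: "((\<lambda>y. h (fst y)) \<longlongrightarrow> h (fst x)) ?F" if "continuous_map (eq_space N) euclideanreal h" for h
    using tendsto_atin_if_continuous_map[OF continuous_map_compose[OF continuous_map_fst that] x[unfolded rep_space_def]]
    unfolding rep_space_def by (simp add: o_def)
  note coeffs = eq_space_continuous[THEN comp]
  have snd: "(snd \<longlongrightarrow> snd x) ?F"
  proof (rule tendsto_atin_if_continuous_map[OF _ x])
    show "continuous_map (rep_space N) euclidean snd"
      using continuous_map_into_fulltopology[OF continuous_map_snd] unfolding rep_space_def .
  qed
  have sol: "((\<lambda>y. poly (solY (fst y) U V n) z) \<longlongrightarrow> poly (solY (fst x) U V n) z) ?F \<and>
      ((\<lambda>y. poly (solF (fst y) U V n) z) \<longlongrightarrow> poly (solF (fst x) U V n) z) ?F" if "n \<le> N" for n U V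
    using that
  proof (induction n)
    case (Suc n)
    then have IH: "((\<lambda>y. poly (solY (fst y) U V n) z) \<longlongrightarrow> poly (solY (fst x) U V n) z) ?F"
      "((\<lambda>y. poly (solF (fst y) U V n) z) \<longlongrightarrow> poly (solF (fst x) U V n) z) ?F" by auto
    show ?case
      unfolding sl_sol.simps Let_def fst_conv snd_conv poly_add poly_mult poly_smult poly_pCons poly_0
      using Suc.prems by (intro conjI tendsto_intros IH coeffs) auto
  qed simp
  have entry: "((\<lambda>y. fst (snd y) $ i $ j) \<longlongrightarrow> fst (snd x) $ i $ j) ?F"
    "((\<lambda>y. snd (snd y) $ i $ j) \<longlongrightarrow> snd (snd x) $ i $ j) ?F" for i j
    by (intro tendsto_vec_nth tendsto_fst[OF snd] tendsto_snd[OF snd])+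
  have row: "((\<lambda>y. poly (bc_poly N (fst y) (snd y) i U V) z) \<longlongrightarrow> poly (bc_poly N (fst x) (snd x) i U V) z) ?F" for i U V
    unfolding bc_poly_def poly_add poly_smult
    by (intro tendsto_add tendsto_mult entry tendsto_const sol[OF order_refl, THEN conjunct1]
        sol[OF order_refl, THEN conjunct2])
  show ?thesis
    unfolding char_poly_def poly_diff poly_mult by (intro tendsto_intros row)
qed

lemma sl_representative_if_rep_space:
  assumes "2 \<le> N" and "x \<in> topspace (rep_space N)"
  shows "sl_representative N (fst (fst x)) (snd (snd (fst x))) (snd x)"
  using assms by unfold_locales (auto simp: rep_space_def eq_space_def)

section \<open>Semicontinuity of the spectrum\<close>

lemma count_mset_concat_replicate:
  "distinct xs \<Longrightarrow> count (mset (concat (map (\<lambda>x. replicate (f x) x) xs))) y = (if y \<in> set xs then f y else 0)"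
  by (induction xs) auto

lemma sorted_concat_replicate:
  "sorted xs \<Longrightarrow> sorted (concat (map (\<lambda>x. replicate (f x) x) xs))"
  by (induction xs) (auto simp: sorted_append sorted_replicate)

lemma count_image_mset_Re:
  "(\<And>r. r \<in># R \<Longrightarrow> Im r = 0) \<Longrightarrow> count (image_mset Re R) y = count R (complex_of_real y)"
proof (induction R)
  case (add r R)
  have "Re r = y \<longleftrightarrow> r = complex_of_real y"
    using add.prems[of r] by (auto simp: complex_eq_iff)
  with add show ?case by auto
qed simp

lemma length_filter_eq_size: "length (filter Q xs) = size (filter_mset Q (mset xs))"
  by (metis mset_filter size_mset)

context
  fixes N :: nat and x :: "sl_equation \<times> (mat22 \<times> mat22)"
  assumes N: "2 \<le> N" and x: "x \<in> topspace (rep_space N)"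
begin

private abbreviation "p \<equiv> char_poly N (fst x) (snd x)"

lemma char_poly_of_slp:
  shows "p \<noteq> 0" and "poly p r = 0 \<Longrightarrow> Im r = 0"
    and "eigenvalues N (slp_of x) = {r. poly p r = 0}"
    and "eig_mult N (slp_of x) r = order r p"
proof -
  interpret sl_representative N "fst (fst x)" "fst (snd (fst x))" "snd (snd (fst x))" "snd x"
    by (rule sl_representative_if_rep_space[OF N x])
  show "p \<noteq> 0" and "poly p r = 0 \<Longrightarrow> Im r = 0"
    and "eigenvalues N (slp_of x) = {r. poly p r = 0}"
    and "eig_mult N (slp_of x) r = order r p"
    using char_poly_nonzero char_poly_root_real[of r] eigenvalues_eq eig_mult_eq_order[of r]
    by (simp_all add: slp_of_def)
qed

lemma has_exactly_iff_size_proots: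
  "has_exactly N (slp_of x) j S \<longleftrightarrow> size {#r \<in># proots p. r \<in> S#} = j"
proof -
  have set: "set_mset {#r \<in># proots p. r \<in> S#} = {r. poly p r = 0} \<inter> S"
    using char_poly_of_slp(1) by auto
  then have fin: "finite ({r. poly p r = 0} \<inter> S)"
    by (metis finite_set_mset)
  have "size {#r \<in># proots p. r \<in> S#} = (\<Sum>r\<in>{r. poly p r = 0} \<inter> S. count {#r \<in># proots p. r \<in> S#} r)"
    unfolding size_multiset_overloaded_eq set ..
  also have "\<dots> = (\<Sum>r\<in>{r. poly p r = 0} \<inter> S. order r p)"
    using char_poly_of_slp(1) by (intro sum.cong) auto
  finally show ?thesis
    using fin by (simp add: has_exactly_def char_poly_of_slp(3,4))
qed

text \<open>All roots are real, so taking real parts loses nothing and the root multiset can be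
  replaced by a sorted real list.\<close>

lemma mset_eig_list: "mset (eig_list N (slp_of x)) = image_mset Re (proots p)"
proof (rule multiset_eqI)
  fix y
  let ?S = "{y. complex_of_real y \<in> eigenvalues N (slp_of x)}"
  have "finite {r. poly p r = 0}" using char_poly_of_slp(1) by (rule poly_roots_finite)
  then have fin: "finite ?S"
    unfolding char_poly_of_slp(3) by (intro finite_vimageI[of _ complex_of_real, unfolded vimage_def] injI) auto
  have "count (mset (eig_list N (slp_of x))) y = (if y \<in> ?S then eig_mult N (slp_of x) (of_real y) else 0)"
    unfolding eig_list_def using fin by (subst count_mset_concat_replicate) auto
  also have "\<dots> = order (of_real y) p"
    using order_0I[of p "of_real y"] by (auto simp: char_poly_of_slp)
  also have "\<dots> = count (image_mset Re (proots p)) y"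
    using char_poly_of_slp(1,2) by (subst count_image_mset_Re) auto
  finally show "count (mset (eig_list N (slp_of x))) y = count (image_mset Re (proots p)) y" .
qed

lemma length_filter_eig_list:
  "length (filter Q (eig_list N (slp_of x))) = size {#r \<in># proots p. Q (Re r)#}"
  unfolding length_filter_eq_size mset_eig_list by (simp add: filter_mset_image_mset)

lemma count_eig_list: "count (mset (eig_list N (slp_of x))) y = order (complex_of_real y) p"
  unfolding mset_eig_list using char_poly_of_slp(1,2) by (subst count_image_mset_Re) auto

end

section \<open>Local behaviour of the eigenvalue list\<close>

lemma sorted_eig_list: "sorted (eig_list N P)"
  unfolding eig_list_def by (intro sorted_concat_replicate) simp

text \<open>An eigenvalue of multiplicity n + 1 yields a strict inequality between the values at t +
  \<i>d and t + \<i>e, with the constant \<open>2 ^ (2 * N)\<close> that fits every problem. The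
  inequality persists nearby and there certifies n + 1 roots within e of t.\<close>

lemma count_eig_list_le_near:
  assumes N: "2 \<le> N" and P: "P \<in> topspace (slp_space N)" and "0 < e"
  obtains U where "openin (slp_space N) U" "P \<in> U"
    "\<And>P'. P' \<in> U \<Longrightarrow> count (mset (eig_list N P)) t \<le> length (filter (\<lambda>s. s \<in> ball t e) (eig_list N P'))"
proof -
  obtain x where x: "x \<in> topspace (rep_space N)" and Px: "P = slp_of x"
    using P unfolding topspace_slp_space by blast
  define p where "p y = char_poly N (fst y) (snd y)" for y
  show ?thesis
  proof (cases "order (of_real t) (p x)")
    case 0
    have "count (mset (eig_list N P)) t = 0"
      using 0 count_eig_list[OF N x, of t] unfolding Px p_def by simp
    then show ?thesis
      by (intro that[OF openin_topspace P]) linarith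
  next
    case (Suc n)
    have "poly (p x) (of_real t + \<i> * of_real e) \<noteq> 0"
      using char_poly_of_slp(2)[OF N x, of "of_real t + \<i> * of_real e"] \<open>0 < e\<close> unfolding p_def by auto
    then obtain d where d: "0 < d" "d \<le> e" and less: "(e / d) ^ n * 2 ^ (2 * N) * cmod (poly (p x) (of_real t + \<i> * of_real d))
        < cmod (poly (p x) (of_real t + \<i> * of_real e))"
      using multiple_root_shift_less[of n t "p x" e "2 * N"] Suc \<open>0 < e\<close> by auto
    define Q where "Q y \<longleftrightarrow> (e / d) ^ n * 2 ^ (2 * N) * cmod (poly (p y) (of_real t + \<i> * of_real d))
        < cmod (poly (p y) (of_real t + \<i> * of_real e))" for y
    have lim: "((\<lambda>y. cmod (poly (p y) (of_real t + \<i> * of_real e)) -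
        (e / d) ^ n * 2 ^ (2 * N) * cmod (poly (p y) (of_real t + \<i> * of_real d))) \<longlongrightarrow>
        cmod (poly (p x) (of_real t + \<i> * of_real e)) -
        (e / d) ^ n * 2 ^ (2 * N) * cmod (poly (p x) (of_real t + \<i> * of_real d))) (atin (rep_space N) x)"
      unfolding p_def
      by (intro tendsto_diff tendsto_mult tendsto_norm tendsto_const tendsto_char_poly x)
    have "eventually Q (atin (rep_space N) x)"
      using order_tendstoD(1)[OF lim, of 0] less unfolding Q_def by simp
    then obtain U where U: "openin (slp_space N) U" "slp_of x \<in> U"
      "\<And>P. P \<in> U \<Longrightarrow> \<exists>y\<in>topspace (rep_space N). P = slp_of y \<and> Q y"
      using slp_space_neighbourhood[OF x, of Q] less unfolding Q_def by blast
    show ?thesis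
    proof (rule that[OF U(1)])
      show "P \<in> U" using U(2) Px by simp
      fix P' assume "P' \<in> U"
      then obtain y where y: "y \<in> topspace (rep_space N)" "P' = slp_of y" "Q y" using U(3) by blast
      have "n < size {#r \<in># proots (p y). cmod (r - of_real t) < e#}"
        using char_poly_of_slp(1,2)[OF N y(1)] degree_char_poly[of N "fst y" "snd y"] y(3)
        unfolding p_def Q_def by (intro real_rooted_count_roots_ge[OF d]) auto
      also have "{#r \<in># proots (p y). cmod (r - of_real t) < e#} = {#r \<in># proots (p y). Re r \<in> ball t e#}"
        using char_poly_of_slp(1,2)[OF N y(1)] unfolding p_def
        by (intro filter_mset_cong) (auto simp: cmod_eq_Re dist_real_def abs_minus_commute)
      finally show "count (mset (eig_list N P)) t \<le> length (filter (\<lambda>s. s \<in> ball t e) (eig_list N P'))"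
        using Suc unfolding y(2) Px length_filter_eig_list[OF N y(1)] count_eig_list[OF N x] p_def by simp
    qed
  qed
qed

text \<open>The radius d serves all problems close to P at once: the strict inequality required by
  \<open>real_rooted_no_root_near\<close> holds at P and is an open condition.\<close>

lemma eig_list_avoids_near:
  assumes N: "2 \<le> N" and P: "P \<in> topspace (slp_space N)" and t: "t \<notin> set (eig_list N P)"
  obtains d U where "0 < d" "openin (slp_space N) U" "P \<in> U"
    "\<And>P'. P' \<in> U \<Longrightarrow> set (eig_list N P') \<inter> ball t d = {}"
proof -
  obtain x where x: "x \<in> topspace (rep_space N)" and Px: "P = slp_of x"
    using P unfolding topspace_slp_space by blast
  define p where "p y = char_poly N (fst y) (snd y)" for y
  have "count (mset (eig_list N P)) t = 0" using t by (simp add: count_eq_zero_iff)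
  then have "poly (p x) (of_real t) \<noteq> 0"
    unfolding Px count_eig_list[OF N x] p_def using char_poly_of_slp(1)[OF N x] by (simp add: order_root)
  \<comment> \<open>The added 1 makes the inequality strict: d |p(t + \<i>)| = |p(t)| - d.\<close>
  moreover define d where "d = cmod (poly (p x) (of_real t)) / (1 + cmod (poly (p x) (of_real t + \<i>)))"
  ultimately have "0 < d" by (simp add: add_pos_nonneg)
  define Q where "Q y \<longleftrightarrow> d * cmod (poly (p y) (of_real t + \<i>)) < cmod (poly (p y) (of_real t))" for y
  have "d * (1 + cmod (poly (p x) (of_real t + \<i>))) = cmod (poly (p x) (of_real t))"
    unfolding d_def by (simp add: add_pos_nonneg less_imp_neq[symmetric])
  with \<open>0 < d\<close> have Qx: "Q x" unfolding Q_def by (simp add: distrib_left)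
  have lim: "((\<lambda>y. cmod (poly (p y) (of_real t)) - d * cmod (poly (p y) (of_real t + \<i>))) \<longlongrightarrow>
      cmod (poly (p x) (of_real t)) - d * cmod (poly (p x) (of_real t + \<i>))) (atin (rep_space N) x)"
    unfolding p_def
    by (intro tendsto_diff tendsto_mult tendsto_norm tendsto_const tendsto_char_poly x)
  have "eventually Q (atin (rep_space N) x)"
    using order_tendstoD(1)[OF lim, of 0] Qx unfolding Q_def by simp
  then obtain U where U: "openin (slp_space N) U" "slp_of x \<in> U"
    "\<And>P. P \<in> U \<Longrightarrow> \<exists>y\<in>topspace (rep_space N). P = slp_of y \<and> Q y"
    using slp_space_neighbourhood[OF x, of Q] Qx by blast
  show ?thesis
  proof (rule that[OF \<open>0 < d\<close> U(1)])
    show "P \<in> U" using U(2) Px by simp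
    fix P' assume "P' \<in> U"
    then obtain y where y: "y \<in> topspace (rep_space N)" "P' = slp_of y" "Q y" using U(3) by blast
    show "set (eig_list N P') \<inter> ball t d = {}"
    proof (rule ccontr)
      assume "\<not> ?thesis"
      then obtain s where s: "s \<in> set (eig_list N P')" "s \<in> ball t d" by blast
      have "count (mset (eig_list N P')) s \<noteq> 0" using s(1) by simp
      then have "poly (p y) (of_real s) = 0"
        unfolding y(2) count_eig_list[OF N y(1)] p_def
        by (rule contrapos_np) (rule order_0I)
      from real_rooted_no_root_near[OF _ _ y(3)[unfolded Q_def] this]
      have "d < cmod (of_real s - of_real t)"
        using char_poly_of_slp(1,2)[OF N y(1)] unfolding p_def by blast
      with s(2) show False
        by (simp add: dist_real_def abs_minus_commute flip: of_real_diff)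
    qed
  qed
qed

text \<open>To avoid counting an eigenvalue twice, a closed ball around the new point is removed
  from S and the induction hypothesis is used for the open remainder; hence S varies in the
  induction.\<close>

lemma sum_count_eig_list_le_near:
  assumes N: "2 \<le> N" and P: "P \<in> topspace (slp_space N)" and "finite T" and "T \<subseteq> S" and "open S"
  shows "\<exists>U. openin (slp_space N) U \<and> P \<in> U \<and>
    (\<forall>P'\<in>U. (\<Sum>t\<in>T. count (mset (eig_list N P)) t) \<le> length (filter (\<lambda>s. s \<in> S) (eig_list N P')))"
  using assms(3-)
proof (induction T arbitrary: S rule: finite_induct)
  case empty
  then show ?case using P by (intro exI[of _ "topspace (slp_space N)"]) auto
next
  case (insert t T)
  have "open (S - T)" using insert by (intro open_Diff finite_imp_closed) auto
  moreover have "t \<in> S - T" using insert by auto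
  ultimately obtain e where e: "0 < e" "cball t e \<subseteq> S - T"
    using open_contains_cball by blast
  have "open (S - cball t e)" using insert by auto
  moreover have "T \<subseteq> S - cball t e" using e insert by auto
  ultimately obtain U where U: "openin (slp_space N) U" "P \<in> U"
    "\<And>P'. P' \<in> U \<Longrightarrow> (\<Sum>t\<in>T. count (mset (eig_list N P)) t) \<le> length (filter (\<lambda>s. s \<in> S - cball t e) (eig_list N P'))"
    using insert.IH[of "S - cball t e"] by blast
  obtain V where V: "openin (slp_space N) V" "P \<in> V"
    "\<And>P'. P' \<in> V \<Longrightarrow> count (mset (eig_list N P)) t \<le> length (filter (\<lambda>s. s \<in> ball t e) (eig_list N P'))"
    using count_eig_list_le_near[OF N P e(1)] by blast
  have len: "length (filter (\<lambda>s. s \<in> ball t e) xs) + length (filter (\<lambda>s. s \<in> S - cball t e) xs)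
      \<le> length (filter (\<lambda>s. s \<in> S) xs)" for xs
  proof (induction xs)
    case (Cons a xs)
    have "a \<in> ball t e \<Longrightarrow> a \<in> cball t e \<and> a \<in> S"
      using e(2) ball_subset_cball[of t e] by blast
    with Cons show ?case by (auto simp del: mem_ball mem_cball)
  qed simp
  have "(\<Sum>t\<in>insert t T. count (mset (eig_list N P)) t) \<le> length (filter (\<lambda>s. s \<in> S) (eig_list N P'))"
    if "P' \<in> U \<inter> V" for P'
    using U(3)[of P'] V(3)[of P'] len[of "eig_list N P'"] that insert.hyps by simp
  then show ?case
    using U V by (intro exI[of _ "U \<inter> V"]) auto
qed

text \<open>Only this inequality can be expected: nearby problems may gain eigenvalues in S through
  its boundary or from infinity.\<close>

lemma eig_count_lower_semicontinuous:
  assumes N: "2 \<le> N" and P: "P \<in> topspace (slp_space N)" and "open S"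
  shows "\<exists>U. openin (slp_space N) U \<and> P \<in> U \<and>
    (\<forall>P'\<in>U. length (filter (\<lambda>s. s \<in> S) (eig_list N P)) \<le> length (filter (\<lambda>s. s \<in> S) (eig_list N P')))"
proof -
  let ?T = "set (eig_list N P) \<inter> S"
  have "length (filter (\<lambda>s. s \<in> S) (eig_list N P)) = (\<Sum>t\<in>?T. count (mset (eig_list N P)) t)"
    unfolding length_filter_eq_size size_multiset_overloaded_eq by (intro sum.cong) auto
  then show ?thesis
    using sum_count_eig_list_le_near[OF N P, of ?T S] \<open>open S\<close> by simp
qed

lemma eig_list_avoids_compact:
  assumes N: "2 \<le> N" and P: "P \<in> topspace (slp_space N)" and K: "compact K" "set (eig_list N P) \<inter> K = {}"
  shows "\<exists>U. openin (slp_space N) U \<and> P \<in> U \<and> (\<forall>P'\<in>U. set (eig_list N P') \<inter> K = {})"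
proof -
  have "\<forall>t\<in>K. \<exists>d U. 0 < d \<and> openin (slp_space N) U \<and> P \<in> U \<and> (\<forall>P'\<in>U. set (eig_list N P') \<inter> ball t d = {})"
    using eig_list_avoids_near[OF N P] K(2) by (metis disjoint_iff)
  then obtain d U where dU: "\<And>t. t \<in> K \<Longrightarrow> 0 < d t \<and> openin (slp_space N) (U t) \<and> P \<in> U t \<and>
      (\<forall>P'\<in>U t. set (eig_list N P') \<inter> ball t (d t) = {})"
    by metis
  have "K \<subseteq> (\<Union>t\<in>K. ball t (d t))" using dU by fastforce
  then obtain T where T: "T \<subseteq> K" "finite T" "K \<subseteq> (\<Union>t\<in>T. ball t (d t))"
    using compactE_image[OF K(1), of K "\<lambda>t. ball t (d t)"] by auto
  \<comment> \<open>The intersection with the whole space takes care of an empty cover.\<close>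
  show ?thesis
  proof (intro exI[of _ "(\<Inter>t\<in>T. U t) \<inter> topspace (slp_space N)"] conjI ballI)
    show "openin (slp_space N) ((\<Inter>t\<in>T. U t) \<inter> topspace (slp_space N))"
      using T dU by (intro openin_INT) auto
    show "P \<in> (\<Inter>t\<in>T. U t) \<inter> topspace (slp_space N)"
      using T dU P by auto
    fix P' assume P': "P' \<in> (\<Inter>t\<in>T. U t) \<inter> topspace (slp_space N)"
    show "set (eig_list N P') \<inter> K = {}"
    proof (rule ccontr)
      assume "\<not> ?thesis"
      then obtain s where s: "s \<in> set (eig_list N P')" "s \<in> K" by blast
      then obtain t where "t \<in> T" "s \<in> ball t (d t)" using T(3) by blast
      with dU[of t] T(1) P' s(1) show False by blast
    qed
  qed
qed

section \<open>Eigenvalues on a connected set of problems\<close>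

lemma eig_list_counts:
  assumes N: "2 \<le> N" and P: "P \<in> topspace (slp_space N)"
  shows "has_exactly N P j UNIV \<longleftrightarrow> length (eig_list N P) = j"
    and "has_exactly N P j (complex_of_real ` S) \<longleftrightarrow> length (filter (\<lambda>s. s \<in> S) (eig_list N P)) = j"
    and "s \<in> set (eig_list N P) \<longleftrightarrow> complex_of_real s \<in> eigenvalues N P"
proof -
  obtain x where x: "x \<in> topspace (rep_space N)" and Px: "P = slp_of x"
    using P unfolding topspace_slp_space by blast
  let ?p = "char_poly N (fst x) (snd x)"
  show "has_exactly N P j UNIV \<longleftrightarrow> length (eig_list N P) = j"
    using length_filter_eig_list[OF N x, of "\<lambda>_. True"] has_exactly_iff_size_proots[OF N x, of j UNIV]
    unfolding Px by simp
  have "{#r \<in># proots ?p. r \<in> complex_of_real ` S#} = {#r \<in># proots ?p. Re r \<in> S#}"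
  proof (rule filter_mset_cong[OF refl])
    fix r assume "r \<in># proots ?p"
    then have "r = complex_of_real (Re r)"
      using char_poly_of_slp(1,2)[OF N x] by (simp add: complex_eq_iff)
    then show "r \<in> complex_of_real ` S \<longleftrightarrow> Re r \<in> S" by (metis Re_complex_of_real image_iff)
  qed
  then show "has_exactly N P j (complex_of_real ` S) \<longleftrightarrow> length (filter (\<lambda>s. s \<in> S) (eig_list N P)) = j"
    unfolding Px has_exactly_iff_size_proots[OF N x] length_filter_eig_list[OF N x] by simp
  have "s \<in> set (eig_list N P) \<longleftrightarrow> count (mset (eig_list N P)) s \<noteq> 0"
    by (simp add: count_eq_zero_iff)
  also have "\<dots> \<longleftrightarrow> poly ?p (of_real s) = 0"
    unfolding Px count_eig_list[OF N x] using char_poly_of_slp(1)[OF N x] by (simp add: order_root)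
  also have "\<dots> \<longleftrightarrow> complex_of_real s \<in> eigenvalues N P"
    unfolding Px char_poly_of_slp(3)[OF N x] by simp
  finally show "s \<in> set (eig_list N P) \<longleftrightarrow> complex_of_real s \<in> eigenvalues N P" .
qed

section \<open>Positions in sorted lists\<close>

lemma sorted_eq_filter_append:
  fixes xs :: "'a::linorder list"
  assumes "sorted xs" and "\<And>x y. x \<le> y \<Longrightarrow> Q y \<Longrightarrow> Q x"
  shows "xs = filter Q xs @ filter (\<lambda>x. \<not> Q x) xs"
  using assms(1)
proof (induction xs)
  case (Cons x xs)
  show ?case
  proof (cases "Q x")
    case False
    then have "\<not> Q y" if "y \<in> set xs" for y using Cons.prems assms(2)[of x y] that by auto
    then show ?thesis using False by (simp add: filter_empty_conv filter_True)
  qed (use Cons in simp)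
qed simp

text \<open>Turns a bound on the entry at position i into a bound on a count, which is how
  semicontinuity of counts reaches single eigenvalues.\<close>

lemma sorted_nth_iff:
  fixes xs :: "'a::linorder list"
  assumes "sorted xs" and "\<And>x y. x \<le> y \<Longrightarrow> Q y \<Longrightarrow> Q x" and i: "i < length xs"
  shows "Q (xs ! i) \<longleftrightarrow> i < length (filter Q xs)"
proof -
  have eq: "xs = filter Q xs @ filter (\<lambda>x. \<not> Q x) xs"
    using assms(1,2) by (rule sorted_eq_filter_append)
  show ?thesis
  proof
    assume less: "i < length (filter Q xs)"
    have "xs ! i = filter Q xs ! i"
      using less by (subst eq) (simp add: nth_append)
    then show "Q (xs ! i)" using nth_mem[OF less] by simp
  next
    assume "Q (xs ! i)"
    show "i < length (filter Q xs)"
    proof (rule ccontr)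
      assume n: "\<not> ?thesis"
      have len: "length xs = length (filter Q xs) + length (filter (\<lambda>x. \<not> Q x) xs)"
        by (subst eq) simp
      have less: "i - length (filter Q xs) < length (filter (\<lambda>x. \<not> Q x) xs)"
        using n i len by linarith
      have "xs ! i = filter (\<lambda>x. \<not> Q x) xs ! (i - length (filter Q xs))"
        using n by (subst eq) (simp add: nth_append)
      then show False using nth_mem[OF less] \<open>Q (xs ! i)\<close> by simp
    qed
  qed
qed

lemma sorted_nth_less_iff:
  fixes xs :: "'a::linorder list"
  assumes "sorted xs" "i < length xs"
  shows "xs ! i < a \<longleftrightarrow> i < length (filter (\<lambda>x. x < a) xs)"
  using sorted_nth_iff[of xs "\<lambda>x. x < a" i] assms by (meson le_less_trans)

lemma sorted_nth_greater_iff: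
  fixes xs :: "'a::linorder list"
  assumes "sorted xs" "i < length xs"
  shows "a < xs ! i \<longleftrightarrow> length xs \<le> i + length (filter (\<lambda>x. a < x) xs)"
proof -
  have "xs ! i \<le> a \<longleftrightarrow> i < length (filter (\<lambda>x. x \<le> a) xs)"
    using sorted_nth_iff[of xs "\<lambda>x. x \<le> a" i] assms by (meson order_trans)
  moreover have "length (filter (\<lambda>x. x \<le> a) xs) + length (filter (\<lambda>x. a < x) xs) = length xs"
    using sum_length_filter_compl[of "\<lambda>x. x \<le> a" xs] by (simp add: not_le)
  ultimately show ?thesis by (auto simp: not_le[symmetric])
qed

text \<open>The list splits into blocks below a, inside, and above b. Deleting the middle block of
  length m moves exactly the positions from c on.\<close>

lemma sorted_nth_filter_outside:
  fixes xs :: "'a::linorder list" and a b :: 'a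
  assumes s: "sorted xs" and "a \<le> b" and i: "i < length (filter (\<lambda>x. x \<notin> {a..b}) xs)"
  defines "c \<equiv> length (filter (\<lambda>x. x < a) xs)" and "m \<equiv> length (filter (\<lambda>x. x \<in> {a..b}) xs)"
  shows "filter (\<lambda>x. x \<notin> {a..b}) xs ! i = xs ! (if i < c then i else i + m)"
    and "if i < c then filter (\<lambda>x. x \<notin> {a..b}) xs ! i < a else b < filter (\<lambda>x. x \<notin> {a..b}) xs ! i"
proof -
  let ?A = "filter (\<lambda>x. x < a) xs" and ?B = "filter (\<lambda>x. x \<in> {a..b}) xs" and ?C = "filter (\<lambda>x. b < x) xs"
  have "xs = ?A @ filter (\<lambda>x. \<not> x < a) xs"
    using s by (rule sorted_eq_filter_append) auto
  also have "filter (\<lambda>x. \<not> x < a) xs =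
      filter (\<lambda>x. x \<le> b) (filter (\<lambda>x. \<not> x < a) xs) @ filter (\<lambda>x. \<not> x \<le> b) (filter (\<lambda>x. \<not> x < a) xs)"
    using sorted_wrt_filter[OF s] by (rule sorted_eq_filter_append) auto
  also have "filter (\<lambda>x. x \<le> b) (filter (\<lambda>x. \<not> x < a) xs) = ?B"
    by (auto intro: filter_cong)
  also have "filter (\<lambda>x. \<not> x \<le> b) (filter (\<lambda>x. \<not> x < a) xs) = ?C"
    using \<open>a \<le> b\<close> by (auto intro!: filter_cong)
  finally have xs: "xs = ?A @ ?B @ ?C" .
  have "filter (\<lambda>x. x \<notin> {a..b}) xs = filter (\<lambda>x. x \<notin> {a..b}) ?A @ filter (\<lambda>x. x \<notin> {a..b}) ?B @ filter (\<lambda>x. x \<notin> {a..b}) ?C"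
    by (subst xs) (simp only: filter_append)
  also have "filter (\<lambda>x. x \<notin> {a..b}) ?A = ?A" by (rule filter_True) auto
  also have "filter (\<lambda>x. x \<notin> {a..b}) ?B = []" by (auto simp: filter_empty_conv)
  also have "filter (\<lambda>x. x \<notin> {a..b}) ?C = ?C" by (rule filter_True) auto
  finally have hat: "filter (\<lambda>x. x \<notin> {a..b}) xs = ?A @ ?C" by simp
  show "filter (\<lambda>x. x \<notin> {a..b}) xs ! i = xs ! (if i < c then i else i + m)"
  proof -
    have "(as @ cs) ! i = (as @ bs @ cs) ! (if i < length as then i else i + length bs)" for as bs cs :: "'a list"
      by (cases "i < length as") (auto simp: nth_append not_less le_iff_add)
    then have "(?A @ ?C) ! i = (?A @ ?B @ ?C) ! (if i < c then i else i + m)"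
      unfolding c_def m_def .
    then show ?thesis unfolding hat xs[symmetric] .
  qed
  show "if i < c then filter (\<lambda>x. x \<notin> {a..b}) xs ! i < a else b < filter (\<lambda>x. x \<notin> {a..b}) xs ! i"
  proof (cases "i < c")
    case True
    then have "(?A @ ?C) ! i = ?A ! i" "?A ! i \<in> set ?A" unfolding c_def by (simp only: nth_append if_True nth_mem)+
    with True show ?thesis unfolding hat by simp
  next
    case False
    then have "(?A @ ?C) ! i = ?C ! (i - length ?A)" "?C ! (i - length ?A) \<in> set ?C"
      using i unfolding hat c_def by (simp_all only: nth_append if_False, intro nth_mem, simp)
    with False show ?thesis unfolding hat by simp
  qed
qed

text \<open>Local constancy is continuity into a discrete space, where a connected image has at most
  one point.\<close>

lemma locally_constant_on_connectedin:
  assumes "connectedin X S"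
    and loc: "\<And>x. x \<in> S \<Longrightarrow> \<exists>U. openin X U \<and> x \<in> U \<and> (\<forall>y\<in>U \<inter> S. f y = f x)"
  obtains c where "\<And>x. x \<in> S \<Longrightarrow> f x = c"
proof -
  have S: "S \<subseteq> topspace X" using assms(1) by (rule connectedin_subset_topspace)
  have "continuous_map (subtopology X S) (discrete_topology UNIV) f"
    unfolding continuous_map_def
  proof (intro conjI allI impI)
    fix V
    show "openin (subtopology X S) {x \<in> topspace (subtopology X S). f x \<in> V}" (is "openin _ ?W")
    proof (subst openin_subopen, intro ballI)
      fix x assume "x \<in> ?W"
      then have x: "x \<in> S" "f x \<in> V" by auto
      with loc obtain U where U: "openin X U" "x \<in> U" "\<forall>y\<in>U \<inter> S. f y = f x" by blast
      show "\<exists>T. openin (subtopology X S) T \<and> x \<in> T \<and> T \<subseteq> ?W"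
      proof (intro exI[of _ "U \<inter> S"] conjI)
        show "openin (subtopology X S) (U \<inter> S)" using U(1) unfolding openin_subtopology by blast
        show "x \<in> U \<inter> S" using U(2) x(1) by blast
        show "U \<inter> S \<subseteq> ?W" using U(3) x(2) S by auto
      qed
    qed
  qed simp
  moreover have "connectedin (subtopology X S) S" using assms(1) by (simp add: connectedin_subtopology)
  ultimately have "connectedin (discrete_topology UNIV) (f ` S)"
    by (rule connectedin_continuous_map_image)
  then obtain c where "f ` S \<subseteq> {c}" unfolding connectedin_discrete_topology by blast
  then show ?thesis using that by blast
qed

theorem theorem2p3:
  fixes N k m :: nat and r1 r2 :: real and \<O> :: "sl_problem set"
    and E :: "nat \<Rightarrow> real set"
  defines "E \<equiv> \<lambda>i. eig_hat N r1 r2 i ` \<O>"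
  assumes "2 \<le> N"
    and "connectedin (slp_space N) \<O>"
    and "r1 < r2"
    and "m < k"
    and "\<And>P. P \<in> \<O> \<Longrightarrow> has_exactly N P k UNIV"
    and "\<And>P. P \<in> \<O> \<Longrightarrow> has_exactly N P m (complex_of_real ` {r1..r2})"
    and "\<And>P. P \<in> \<O> \<Longrightarrow>
      eigenvalues N P \<inter> complex_of_real ` {r1..r2} \<subseteq> complex_of_real ` {r1<..<r2}"
  shows "(\<forall>i\<in>{1..k - m}.
            (E i \<subseteq> {..<r1} \<or> E i \<subseteq> {r2<..}) \<and>
            (\<exists>i0\<in>{0..k - 1}. \<forall>P\<in>\<O>. eig_hat N r1 r2 i P = eig N i0 P) \<and>
            continuous_map (subtopology (slp_space N) \<O>) euclideanreal (eig_hat N r1 r2 i)) \<and>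
         (\<forall>P0. P0 \<in> (slp_space N closure_of \<O>) - \<O> \<longrightarrow>
            has_exactly N P0 m UNIV \<longrightarrow>
            eigenvalues N P0 \<subseteq> complex_of_real ` {r1<..<r2} \<longrightarrow>
            (\<forall>i\<in>{1..k - m}.
               (E i \<subseteq> {..<r1} \<longrightarrow>
                  filterlim (eig_hat N r1 r2 i) at_bot (atin_within (slp_space N) P0 \<O>)) \<and>
               (E i \<subseteq> {r2<..} \<longrightarrow>
                  filterlim (eig_hat N r1 r2 i) at_top (atin_within (slp_space N) P0 \<O>))))"
proof -
  let ?X = "slp_space N"
  let ?in = "\<lambda>s. s \<in> {r1..r2}" and ?out = "\<lambda>s. s \<notin> {r1..r2}"
  note N = \<open>2 \<le> N\<close>
  have sub: "\<O> \<subseteq> topspace ?X" using assms(3) by (rule connectedin_subset_topspace)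
  have len: "length (eig_list N P) = k" and len_in: "length (filter ?in (eig_list N P)) = m" if "P \<in> \<O>" for P
    using assms(6,7) that sub eig_list_counts(1)[OF N] eig_list_counts(2)[OF N, of P m "{r1..r2}"] by blast+
  have len_out: "length (filter ?out (eig_list N P)) = k - m" if "P \<in> \<O>" for P
    using sum_length_filter_compl[of ?in "eig_list N P"] len[OF that] len_in[OF that] by simp
  have len_out': "length (filter (\<lambda>s. s < r1) (eig_list N P)) + length (filter (\<lambda>s. r2 < s) (eig_list N P)) = k - m"
    if "P \<in> \<O>" for P
  proof -
    have "length (filter (\<lambda>s. s < r1) xs) + length (filter (\<lambda>s. r2 < s) xs) = length (filter ?out xs)" for xs
      using \<open>r1 < r2\<close> by (induction xs) auto
    then show ?thesis using len_out[OF that] by simp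
  qed
  have lsc: "\<exists>U. openin ?X U \<and> P \<in> U \<and>
      (\<forall>P'\<in>U. length (filter (\<lambda>s. s < a) (eig_list N P)) \<le> length (filter (\<lambda>s. s < a) (eig_list N P')))"
    "\<exists>U. openin ?X U \<and> P \<in> U \<and>
      (\<forall>P'\<in>U. length (filter (\<lambda>s. a < s) (eig_list N P)) \<le> length (filter (\<lambda>s. a < s) (eig_list N P')))"
    if "P \<in> \<O>" for P a
    using eig_count_lower_semicontinuous[OF N, of P "{..<a}"] eig_count_lower_semicontinuous[OF N, of P "{a<..}"]
      that sub by auto
  obtain c where c: "\<And>P. P \<in> \<O> \<Longrightarrow> length (filter (\<lambda>s. s < r1) (eig_list N P)) = c"
  proof (rule locally_constant_on_connectedin[OF assms(3), of "\<lambda>P. length (filter (\<lambda>s. s < r1) (eig_list N P))"])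
    fix P assume P: "P \<in> \<O>"
    obtain U V where UV: "openin ?X U" "P \<in> U" "openin ?X V" "P \<in> V"
      "\<And>P'. P' \<in> U \<Longrightarrow> length (filter (\<lambda>s. s < r1) (eig_list N P)) \<le> length (filter (\<lambda>s. s < r1) (eig_list N P'))"
      "\<And>P'. P' \<in> V \<Longrightarrow> length (filter (\<lambda>s. r2 < s) (eig_list N P)) \<le> length (filter (\<lambda>s. r2 < s) (eig_list N P'))"
      using lsc(1)[OF P, of r1] lsc(2)[OF P, of r2] by blast
    have "length (filter (\<lambda>s. s < r1) (eig_list N P')) = length (filter (\<lambda>s. s < r1) (eig_list N P))"
      if "P' \<in> (U \<inter> V) \<inter> \<O>" for P'
      using UV(5,6)[of P'] len_out'[OF P] len_out'[of P'] that by fastforce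
    then show "\<exists>U. openin ?X U \<and> P \<in> U \<and> (\<forall>P'\<in>U \<inter> \<O>.
        length (filter (\<lambda>s. s < r1) (eig_list N P')) = length (filter (\<lambda>s. s < r1) (eig_list N P)))"
      using UV(1-4) by (intro exI[of _ "U \<inter> V"]) auto
  qed blast
  \<comment> \<open>\<open>eig_hat\<close> is numbered from 1 and the list from 0; past the c
    eigenvalues below \<open>r1\<close>, the m eigenvalues inside the interval are skipped. As c is
    the same throughout the connected set, so is the index.\<close>
  define idx where "idx i = (if i - 1 < c then i - 1 else i - 1 + m)" for i
  have hat: "eig_hat N r1 r2 i P = eig_list N P ! idx i"
    and hat_side: "if i - 1 < c then eig_hat N r1 r2 i P < r1 else r2 < eig_hat N r1 r2 i P"
    if "i \<in> {1..k - m}" "P \<in> \<O>" for i P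
  proof -
    have "i - 1 < length (filter ?out (eig_list N P))" using that len_out by auto
    from sorted_nth_filter_outside[OF sorted_eig_list less_imp_le[OF \<open>r1 < r2\<close>] this]
    show "eig_hat N r1 r2 i P = eig_list N P ! idx i"
      "if i - 1 < c then eig_hat N r1 r2 i P < r1 else r2 < eig_hat N r1 r2 i P"
      unfolding c[OF that(2)] len_in[OF that(2)] eig_hat_def idx_def .
  qed
  have idx: "idx i < k" if "i \<in> {1..k - m}" for i
    using that \<open>m < k\<close> by (auto simp: idx_def)
  have hat_in: "eig_hat N r1 r2 i P \<in> set (eig_list N P)" if "i \<in> {1..k - m}" "P \<in> \<O>" for i P
    unfolding hat[OF that] using idx[OF that(1)] len[OF that(2)] by simp
  have cont: "continuous_map (subtopology ?X \<O>) euclideanreal (eig_hat N r1 r2 i)" if i: "i \<in> {1..k - m}" for i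
  proof -
    have top: "topspace (subtopology ?X \<O>) = \<O>" using sub by auto
    \<comment> \<open>An upper bound on an eigenvalue is a lower bound on the count below; a lower
      bound becomes one on the count above because the total is always k. Both are stable by lower
      semicontinuity.\<close>
    have less: "eig_hat N r1 r2 i P < a \<longleftrightarrow> idx i < length (filter (\<lambda>s. s < a) (eig_list N P))"
      and greater: "a < eig_hat N r1 r2 i P \<longleftrightarrow> k \<le> idx i + length (filter (\<lambda>s. a < s) (eig_list N P))"
      if "P \<in> \<O>" for P a
      using sorted_nth_less_iff[OF sorted_eig_list, of "idx i" N P a] sorted_nth_greater_iff[OF sorted_eig_list, of "idx i" N P a]
        hat[OF i that] len[OF that] idx[OF i] by simp_all
    have opn: "openin (subtopology ?X \<O>) {P \<in> \<O>. Q P}"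
      if "\<And>P. P \<in> \<O> \<Longrightarrow> Q P \<Longrightarrow> \<exists>U. openin ?X U \<and> P \<in> U \<and> (\<forall>P'\<in>U \<inter> \<O>. Q P')" for Q
    proof (subst openin_subopen, intro ballI)
      fix P assume "P \<in> {P \<in> \<O>. Q P}"
      with that obtain U where U: "openin ?X U" "P \<in> U" "\<forall>P'\<in>U \<inter> \<O>. Q P'" "P \<in> \<O>" by blast
      then show "\<exists>T. openin (subtopology ?X \<O>) T \<and> P \<in> T \<and> T \<subseteq> {P \<in> \<O>. Q P}"
        by (intro exI[of _ "U \<inter> \<O>"]) (auto simp: openin_subtopology)
    qed
    show ?thesis
      unfolding continuous_map_upper_lower_semicontinuous_lt top
    proof (intro conjI allI opn)
      fix P a assume P: "P \<in> \<O>" and "a < eig_hat N r1 r2 i P"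
      then have "k \<le> idx i + length (filter (\<lambda>s. a < s) (eig_list N P))" using greater by blast
      moreover obtain U where "openin ?X U" "P \<in> U"
        "\<forall>P'\<in>U. length (filter (\<lambda>s. a < s) (eig_list N P)) \<le> length (filter (\<lambda>s. a < s) (eig_list N P'))"
        using lsc(2)[OF P] by blast
      ultimately show "\<exists>U. openin ?X U \<and> P \<in> U \<and> (\<forall>P'\<in>U \<inter> \<O>. a < eig_hat N r1 r2 i P')"
        using greater by (intro exI[of _ U]) fastforce
    next
      fix P a assume P: "P \<in> \<O>" and "eig_hat N r1 r2 i P < a"
      then have "idx i < length (filter (\<lambda>s. s < a) (eig_list N P))" using less by blast
      moreover obtain U where "openin ?X U" "P \<in> U"
        "\<forall>P'\<in>U. length (filter (\<lambda>s. s < a) (eig_list N P)) \<le> length (filter (\<lambda>s. s < a) (eig_list N P'))"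
        using lsc(1)[OF P] by blast
      ultimately show "\<exists>U. openin ?X U \<and> P \<in> U \<and> (\<forall>P'\<in>U \<inter> \<O>. eig_hat N r1 r2 i P' < a)"
        using less by (intro exI[of _ U]) fastforce
    qed
  qed
  \<comment> \<open>The spectrum of \<open>P0\<close> lies in the open interval, so even intervals
    that end at \<open>r1\<close> or start at \<open>r2\<close> are free of it and stay free
    nearby.\<close>
  have avoid: "eventually (\<lambda>P. set (eig_list N P) \<inter> {a..b} = {}) (atin_within ?X P0 \<O>)"
    if P0: "P0 \<in> ?X closure_of \<O>" and ev: "eigenvalues N P0 \<subseteq> complex_of_real ` {r1<..<r2}"
      and ab: "b \<le> r1 \<or> r2 \<le> a" for P0 a b
  proof -
    have P0': "P0 \<in> topspace ?X" using P0 by (simp add: in_closure_of)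
    have disj: "set (eig_list N P0) \<inter> {a..b} = {}"
    proof (rule ccontr)
      assume "\<not> ?thesis"
      then obtain s where "s \<in> set (eig_list N P0)" "s \<in> {a..b}" by blast
      then have "complex_of_real s \<in> complex_of_real ` {r1<..<r2}"
        using ev eig_list_counts(3)[OF N P0'] by blast
      then have "r1 < s" "s < r2" by auto
      with ab \<open>s \<in> {a..b}\<close> show False by auto
    qed
    from eig_list_avoids_compact[OF N P0' compact_Icc disj]
    obtain U where "openin ?X U" "P0 \<in> U" "\<forall>P\<in>U. set (eig_list N P) \<inter> {a..b} = {}"
      by (elim exE conjE)
    then show ?thesis unfolding eventually_atin_within by (intro disjI2 exI[of _ U]) simp
  qed
  have in_O: "eventually (\<lambda>P. P \<in> \<O>) (atin_within ?X P0 \<O>)" for P0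
    unfolding eventually_atin_within by (intro disjCI exI[of _ "topspace ?X"]) simp
  show ?thesis
  proof (intro conjI ballI allI impI)
    fix i assume i: "i \<in> {1..k - m}"
    show "E i \<subseteq> {..<r1} \<or> E i \<subseteq> {r2<..}"
      using hat_side[OF i] unfolding E_def by (cases "i - 1 < c") auto
    show "\<exists>i0\<in>{0..k - 1}. \<forall>P\<in>\<O>. eig_hat N r1 r2 i P = eig N i0 P"
      using hat[OF i] idx[OF i] by (intro bexI[of _ "idx i"]) (auto simp: eig_def)
    show "continuous_map (subtopology ?X \<O>) euclideanreal (eig_hat N r1 r2 i)"
      using i by (rule cont)
  next
    fix P0 i
    assume P0: "P0 \<in> ?X closure_of \<O> - \<O>" and ev: "eigenvalues N P0 \<subseteq> complex_of_real ` {r1<..<r2}"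
      and i: "i \<in> {1..k - m}" and E: "E i \<subseteq> {..<r1}"
    show "filterlim (eig_hat N r1 r2 i) at_bot (atin_within ?X P0 \<O>)"
      unfolding filterlim_at_bot
    proof
      fix Z
      from P0 have "P0 \<in> ?X closure_of \<O>" by blast
      \<comment> \<open>Below \<open>r1\<close> and outside \<open>{Z..r1}\<close> means below Z. If
        Z exceeds \<open>r1\<close>, this interval is empty and the bound is immediate.\<close>
      from avoid[OF this ev disjI1[OF order_refl], of Z] in_O
      show "eventually (\<lambda>P. eig_hat N r1 r2 i P \<le> Z) (atin_within ?X P0 \<O>)"
      proof eventually_elim
        case (elim P)
        then have "eig_hat N r1 r2 i P < r1" using E unfolding E_def by blast
        moreover have "eig_hat N r1 r2 i P \<notin> {Z..r1}" using hat_in[OF i] elim by blast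
        ultimately show ?case by auto
      qed
    qed
  next
    fix P0 i
    assume P0: "P0 \<in> ?X closure_of \<O> - \<O>" and ev: "eigenvalues N P0 \<subseteq> complex_of_real ` {r1<..<r2}"
      and i: "i \<in> {1..k - m}" and E: "E i \<subseteq> {r2<..}"
    show "filterlim (eig_hat N r1 r2 i) at_top (atin_within ?X P0 \<O>)"
      unfolding filterlim_at_top
    proof
      fix Z
      from P0 have "P0 \<in> ?X closure_of \<O>" by blast
      from avoid[OF this ev disjI2[OF order_refl], of Z] in_O
      show "eventually (\<lambda>P. Z \<le> eig_hat N r1 r2 i P) (atin_within ?X P0 \<O>)"
      proof eventually_elim
        case (elim P)
        then have "r2 < eig_hat N r1 r2 i P" using E unfolding E_def by blast
        moreover have "eig_hat N r1 r2 i P \<notin> {r2..Z}" using hat_in[OF i] elim by blast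
        ultimately show ?case by auto
      qed
    qed
  qed
qed

end
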